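(* Let $\mathcal{C}$ be a prevariety over a finite alphabet $A$. Then $\mathit{SF}(\mathcal{C}) = \mathrm{LTL}(\mathcal{C}) = \mathrm{LTLP}(\mathcal{C})$.
   Context: Fix a finite alphabet $A$. A prevariety is a class of regular languages over $A$ containing $\emptyset$ and $A^*$, closed under union, intersection, complement, and under the quotients $u^{-1}L=\{w\mid uw\in L\}$ and $Lu^{-1}=\{w\mid wu\in L\}$. $\mathit{SF}(\mathcal{C})$ is the least class containing $\mathcal{C}$ and all $\{a\}$ ($a\in A$), closed under union, complement and concatenation. A word $w=a_1\cdots a_n$ has positions $\{0,\dots,n+1\}$, position $i\in\{1,\dots,n\}$ carrying label $a_i$, and $0$, $n+1$ unlabeled; for $i<j$, $w(i,j)=a_{i+1}\cdots a_{j-1}$. Formulas of $\mathrm{LTLP}[\mathcal{C}]$ are built from atomic formulas $\top$, $\mathit{min}$, $\mathit{max}$ and $a$ ($a\in A$) using $\vee,\wedge,\neg$ and, for each $L\in\mathcal{C}$, binary modalities $\psi_1\,\mathrm{U}_L\,\psi_2$ (until) and $\psi_1\,\mathrm{S}_L\,\psi_2$ (since). Semantics at a position $i$ of $w$: $\top$ always holds; $a$ holds iff $i$ is labeled $a$; $\mathit{min}$ holds iff $i=0$; $\mathit{max}$ holds iff $i=n+1$; Boolean connectives as usual; $w,i\models\psi_1\,\mathrm{U}_L\,\psi_2$ iff there is $j>i$ with $w(i,j)\in L$, $w,j\models\psi_2$ and $w,k\models\psi_1$ for all $i<k<j$; $w,i\models\psi_1\,\mathrm{S}_L\,\psi_2$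 iff there is $j<i$ with $w(j,i)\in L$, $w,j\models\psi_2$ and $w,k\models\psi_1$ for all $j<k<i$. A formula $\varphi$ defines the language $\{w\mid w,0\models\varphi\}$. $\mathrm{LTL}[\mathcal{C}]$ is the set of $\mathrm{LTLP}[\mathcal{C}]$ formulas without any since-modality. $\mathrm{LTL}(\mathcal{C})$ (resp. $\mathrm{LTLP}(\mathcal{C})$) is the class of languages defined by $\mathrm{LTL}[\mathcal{C}]$ (resp. $\mathrm{LTLP}[\mathcal{C}]$) formulas. *)

theory Defs
  imports Main
begin

text \<open>The finite alphabet A is the universe of a type variable of sort finite;
words are lists, languages are sets of lists.\<close>

definition conc :: "'a list set \<Rightarrow> 'a list set \<Rightarrow> 'a list set" where
  "conc L K = {u @ v | u v. u \<in> L \<and> v \<in> K}"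

inductive_set kstar :: "'a list set \<Rightarrow> 'a list set" for L where
  kstar_nil: "[] \<in> kstar L"
| kstar_app: "u \<in> L \<Longrightarrow> v \<in> kstar L \<Longrightarrow> u @ v \<in> kstar L"

inductive regular :: "'a list set \<Rightarrow> bool" where
  reg_empty: "regular {}"
| reg_eps: "regular {[]}"
| reg_letter: "regular {[a]}"
| reg_union: "regular L \<Longrightarrow> regular K \<Longrightarrow> regular (L \<union> K)"
| reg_conc: "regular L \<Longrightarrow> regular K \<Longrightarrow> regular (conc L K)"
| reg_star: "regular L \<Longrightarrow> regular (kstar L)"

definition lquot :: "'a list \<Rightarrow> 'a list set \<Rightarrow> 'a list set" where
  "lquot u L = {w. u @ w \<in> L}"

definition rquot :: "'a list set \<Rightarrow> 'a list \<Rightarrow> 'a list set" where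
  "rquot L u = {w. w @ u \<in> L}"

definition prevariety :: "('a::finite) list set set \<Rightarrow> bool" where
  "prevariety C \<longleftrightarrow>
     (\<forall>L\<in>C. regular L) \<and> {} \<in> C \<and> UNIV \<in> C \<and>
     (\<forall>L\<in>C. \<forall>K\<in>C. L \<union> K \<in> C) \<and>
     (\<forall>L\<in>C. \<forall>K\<in>C. L \<inter> K \<in> C) \<and>
     (\<forall>L\<in>C. - L \<in> C) \<and>
     (\<forall>L\<in>C. \<forall>u. lquot u L \<in> C) \<and>
     (\<forall>L\<in>C. \<forall>u. rquot L u \<in> C)"

inductive_set SF :: "('a::finite) list set set \<Rightarrow> 'a list set set" for C where
  SF_base: "L \<in> C \<Longrightarrow> L \<in> SF C"
| SF_letter: "{[a]} \<in> SF C"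
| SF_union: "L \<in> SF C \<Longrightarrow> K \<in> SF C \<Longrightarrow> L \<union> K \<in> SF C"
| SF_compl: "L \<in> SF C \<Longrightarrow> - L \<in> SF C"
| SF_conc: "L \<in> SF C \<Longrightarrow> K \<in> SF C \<Longrightarrow> conc L K \<in> SF C"

datatype 'a ltlp =
    TT | Min | Max | Lab 'a
  | Or "'a ltlp" "'a ltlp" | And "'a ltlp" "'a ltlp" | Neg "'a ltlp"
  | Until "'a list set" "'a ltlp" "'a ltlp"
  | Since "'a list set" "'a ltlp" "'a ltlp"

text \<open>Infix w(i,j) = a_{i+1} ... a_{j-1} for positions i < j of w.\<close>
definition infx :: "'a list \<Rightarrow> nat \<Rightarrow> nat \<Rightarrow> 'a list" where
  "infx w i j = take (j - i - 1) (drop i w)"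

text \<open>Positions of w are 0..length w + 1; position i with 1 \<le> i \<le> length w
carries label w ! (i - 1).\<close>
primrec sat :: "'a list \<Rightarrow> nat \<Rightarrow> 'a ltlp \<Rightarrow> bool" where
  "sat w i TT = True"
| "sat w i Min = (i = 0)"
| "sat w i Max = (i = length w + 1)"
| "sat w i (Lab a) = (1 \<le> i \<and> i \<le> length w \<and> w ! (i - 1) = a)"
| "sat w i (Or p q) = (sat w i p \<or> sat w i q)"
| "sat w i (And p q) = (sat w i p \<and> sat w i q)"
| "sat w i (Neg p) = (\<not> sat w i p)"
| "sat w i (Until L p q) = (\<exists>j. i < j \<and> j \<le> length w + 1 \<and> infx w i j \<in> L \<and> sat w j q \<and>
                              (\<forall>k. i < k \<and> k < j \<longrightarrow> sat w k p))"
| "sat w i (Since L p q) = (\<exists>j. j < i \<and> infx w j i \<in> L \<and> sat w j q \<and>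
                              (\<forall>k. j < k \<and> k < i \<longrightarrow> sat w k p))"

primrec mlangs :: "'a ltlp \<Rightarrow> 'a list set set" where
  "mlangs TT = {}" | "mlangs Min = {}" | "mlangs Max = {}" | "mlangs (Lab a) = {}"
| "mlangs (Or p q) = mlangs p \<union> mlangs q"
| "mlangs (And p q) = mlangs p \<union> mlangs q"
| "mlangs (Neg p) = mlangs p"
| "mlangs (Until L p q) = insert L (mlangs p \<union> mlangs q)"
| "mlangs (Since L p q) = insert L (mlangs p \<union> mlangs q)"

primrec future :: "'a ltlp \<Rightarrow> bool" where
  "future TT = True" | "future Min = True" | "future Max = True" | "future (Lab a) = True"
| "future (Or p q) = (future p \<and> future q)"
| "future (And p q) = (future p \<and> future q)"
| "future (Neg p) = future p"
| "future (Until L p q) = (future p \<and> future q)"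
| "future (Since L p q) = False"

definition lang_of :: "'a ltlp \<Rightarrow> 'a list set" where
  "lang_of \<phi> = {w. sat w 0 \<phi>}"

definition LTLP :: "('a::finite) list set set \<Rightarrow> 'a list set set" where
  "LTLP C = {lang_of \<phi> | \<phi>. mlangs \<phi> \<subseteq> C}"

definition LTL :: "('a::finite) list set set \<Rightarrow> 'a list set set" where
  "LTL C = {lang_of \<phi> | \<phi>. mlangs \<phi> \<subseteq> C \<and> future \<phi>}"

end

theory Submission
  imports Defs "HOL-Library.FuncSet" "HOL-Library.Sublist"
begin

text \<open>
  For \<open>LTLP(C) \<subseteq> SF(C)\<close>, consider a formula at the two positions next to a cut of a word
  \<open>u @ v\<close>. By induction on the formula, its truth depends only on the classes of \<open>u\<close> and \<open>v\<close> modulo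
  a congruence of finite index whose classes lie in \<open>SF(C)\<close>.

  For \<open>SF(C) \<subseteq> LTL(C)\<close>, a language \<open>K\<close> of \<open>SF(C)\<close> comes with a finite-index congruence \<open>\<sim>\<close>
  whose classes lie in \<open>C\<close> such that every word \<open>x \<sim> xx\<close> acts aperiodically on the left quotients
  of \<open>K\<close>. Following Wilke's proof for counter-free automata, one defines the words that send a
  state \<open>p\<close> to a state \<open>q\<close> by induction on the number of states and the number of kinds of
  letters. If all letters permute the states, then the class of a word modulo \<open>\<sim>\<close> determines its
  action. Otherwise some letter \<open>c\<close> acts non-injectively; words are cut after each letter that acts
  like \<open>c\<close>, and the blocks become the letters of a new alphabet, which acts on the smaller set of
  states reached by \<open>c\<close>.
\<close>

section \<open>Quotients and languages of finite index\<close>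

lemma mem_lquot_iff [simp]: "w \<in> lquot u L \<longleftrightarrow> u @ w \<in> L"
  by (simp add: lquot_def)

lemma mem_rquot_iff [simp]: "w \<in> rquot L u \<longleftrightarrow> w @ u \<in> L"
  by (simp add: rquot_def)

lemma lquot_Nil [simp]: "lquot [] L = L"
  by auto

lemma lquot_append: "lquot (u @ v) L = lquot v (lquot u L)"
  by auto

lemma lquot_Un: "lquot u (L \<union> K) = lquot u L \<union> lquot u K"
  by auto

lemma lquot_Compl: "lquot u (- L) = - lquot u L"
  by auto

definition tail_lquots :: "'a list set \<Rightarrow> 'a list set \<Rightarrow> 'a list \<Rightarrow> 'a list set set" where
  "tail_lquots L K u = {lquot v K | v. \<exists>u'\<in>L. u = u' @ v}"

lemma lquot_conc: "lquot u (conc L K) = conc (lquot u L) K \<union> \<Union> (tail_lquots L K u)"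
proof (intro set_eqI iffI)
  fix w assume "w \<in> lquot u (conc L K)"
  then obtain p q where pq: "u @ w = p @ q" "p \<in> L" "q \<in> K"
    by (auto simp: conc_def)
  then consider (within_first) x where "p = u @ x" "w = x @ q"
    | (within_second) x where "u = p @ x" "q = x @ w"
    by (auto simp: append_eq_append_conv2)
  then show "w \<in> conc (lquot u L) K \<union> \<Union> (tail_lquots L K u)"
  proof cases
    case within_first
    then show ?thesis using pq by (auto simp: conc_def)
  next
    case within_second
    then have "lquot x K \<in> tail_lquots L K u" "w \<in> lquot x K"
      using pq by (auto simp: tail_lquots_def)
    then show ?thesis by blast
  qed
next
  fix w assume "w \<in> conc (lquot u L) K \<union> \<Union> (tail_lquots L K u)"
  then show "w \<in> lquot u (conc L K)"
    by (auto simp: conc_def tail_lquots_def) (metis append.assoc)+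
qed

lemma kstar_append: "u \<in> kstar L \<Longrightarrow> v \<in> kstar L \<Longrightarrow> u @ v \<in> kstar L"
  by (induction rule: kstar.induct) (auto intro: kstar.intros)

lemma append_in_kstarD:
  assumes "u @ w \<in> kstar L"
  shows "u \<in> kstar L \<and> w \<in> kstar L \<or>
    (\<exists>u' v s t. u = u' @ v \<and> w = s @ t \<and> u' \<in> kstar L \<and> v @ s \<in> L \<and> t \<in> kstar L)"
  using assms
proof (induction "u @ w" arbitrary: u rule: kstar.induct)
  case kstar_nil
  then show ?case by (simp add: kstar.kstar_nil)
next
  case (kstar_app l k)
  then consider (within_first) x where "l = u @ x" "w = x @ k"
    | (within_second) x where "u = l @ x" "k = x @ w"
    by (auto simp: append_eq_append_conv2)
  then show ?case
  proof cases
    case within_first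
    then show ?thesis using kstar_app.hyps kstar.kstar_nil by (metis append_Nil)
  next
    case within_second
    from kstar_app.hyps(3)[OF this(2)] show ?thesis
    proof (elim disjE exE conjE)
      fix u' v s t
      assume "x = u' @ v" "w = s @ t" "u' \<in> kstar L" "v @ s \<in> L" "t \<in> kstar L"
      moreover from this(3) have "l @ u' \<in> kstar L" by (rule kstar.kstar_app[OF kstar_app.hyps(1)])
      ultimately show ?thesis using within_second(1) by (metis append.assoc)
    qed (use within_second kstar_app.hyps(1) in \<open>simp add: kstar.kstar_app\<close>)
  qed
qed

lemma lquot_kstar:
  "lquot u (kstar L) = (if u \<in> kstar L then kstar L else {}) \<union>
    (\<Union>P\<in>tail_lquots (kstar L) L u. conc P (kstar L))" (is "_ = ?K \<union> ?U")
proof (intro set_eqI iffI)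
  fix w assume "w \<in> lquot u (kstar L)"
  then have "u @ w \<in> kstar L" by simp
  from append_in_kstarD[OF this] show "w \<in> ?K \<union> ?U"
  proof (elim disjE exE conjE)
    fix u' v s t
    assume split: "u = u' @ v" "w = s @ t" "u' \<in> kstar L" "v @ s \<in> L" "t \<in> kstar L"
    then have "lquot v L \<in> tail_lquots (kstar L) L u" by (auto simp: tail_lquots_def)
    moreover have "w \<in> conc (lquot v L) (kstar L)" using split by (auto simp: conc_def)
    ultimately show ?thesis by blast
  qed simp
next
  fix w assume "w \<in> ?K \<union> ?U"
  then show "w \<in> lquot u (kstar L)"
  proof
    assume "w \<in> ?U"
    then obtain u' v s t
      where split: "u' \<in> kstar L" "u = u' @ v" "w = s @ t" "v @ s \<in> L" "t \<in> kstar L"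
      by (auto simp: conc_def tail_lquots_def)
    then have "u' @ (v @ s) @ t \<in> kstar L" by (intro kstar_append kstar.kstar_app)
    then show ?thesis using split by simp
  qed (auto split: if_splits intro: kstar_append)
qed

lemma finite_range_factor:
  assumes "finite (range g)" "\<And>x y. g x = g y \<Longrightarrow> f x = f y"
  shows "finite (range f)"
proof -
  obtain h where "f = h \<circ> g" using function_factors_left[of g f] assms(2) by blast
  then have "range f = h ` range g" by (simp add: image_comp)
  then show ?thesis using assms(1) by simp
qed

lemma finite_range_Pair:
  assumes "finite (range f)" "finite (range g)"
  shows "finite (range (\<lambda>x. (f x, g x)))"
  by (rule finite_subset[OF _ finite_cartesian_product[OF assms]]) auto

definition finite_index :: "'a list set \<Rightarrow> bool" where
  "finite_index L \<longleftrightarrow> finite (range (\<lambda>u. lquot u L))"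

lemma finite_index_Un:
  assumes "finite_index L" "finite_index K"
  shows "finite_index (L \<union> K)"
  using finite_range_Pair[OF assms[unfolded finite_index_def]] unfolding finite_index_def
  by (rule finite_range_factor) (simp add: lquot_Un)

lemma finite_index_Compl: "finite_index L \<Longrightarrow> finite_index (- L)"
  unfolding finite_index_def by (erule finite_range_factor) (simp add: lquot_Compl)

lemma finite_range_tail_lquots:
  assumes "finite_index K"
  shows "finite (range (tail_lquots L K))"
proof (rule finite_subset)
  show "range (tail_lquots L K) \<subseteq> Pow (range (\<lambda>u. lquot u K))"
    by (auto simp: tail_lquots_def)
qed (use assms in \<open>simp add: finite_index_def\<close>)

lemma finite_index_conc:
  assumes "finite_index L" "finite_index K"
  shows "finite_index (conc L K)"
  using finite_range_Pair[OF assms(1)[unfolded finite_index_def]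
      finite_range_tail_lquots[OF assms(2), of L]]
  unfolding finite_index_def by (rule finite_range_factor) (simp add: lquot_conc)

lemma finite_index_kstar:
  assumes "finite_index L"
  shows "finite_index (kstar L)"
proof -
  have "finite (range (\<lambda>u. u \<in> kstar L))" by (rule finite_subset[of _ UNIV]) simp_all
  from finite_range_Pair[OF this finite_range_tail_lquots[OF assms, of "kstar L"]]
  show ?thesis unfolding finite_index_def by (rule finite_range_factor) (simp add: lquot_kstar)
qed

lemma finite_index_finite:
  assumes "finite L"
  shows "finite_index L"
proof -
  have "range (\<lambda>u. lquot u L) \<subseteq> Pow (\<Union>w\<in>L. set (suffixes w))"
    by (auto simp: suffix_def)
  then show ?thesis unfolding finite_index_def by (rule finite_subset) (simp add: assms)
qed

lemma regular_finite_index: "regular L \<Longrightarrow> finite_index L"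
  by (induction rule: regular.induct)
    (auto intro: finite_index_finite finite_index_Un finite_index_conc finite_index_kstar)

lemma finite_range_rquot:
  assumes "finite_index L"
  shows "finite (range (rquot L))"
proof -
  let ?Q = "range (\<lambda>u. lquot u L)"
  have "range (\<lambda>v. {K \<in> ?Q. v \<in> K}) \<subseteq> Pow ?Q" by blast
  then have "finite (range (\<lambda>v. {K \<in> ?Q. v \<in> K}))"
    by (rule finite_subset) (use assms in \<open>simp add: finite_index_def\<close>)
  then show ?thesis
  proof (rule finite_range_factor)
    fix v v' assume eq: "{K \<in> ?Q. v \<in> K} = {K \<in> ?Q. v' \<in> K}"
    have rquot: "rquot L x = (\<lambda>u. lquot u L) -` {K \<in> ?Q. x \<in> K}" for x by auto
    show "rquot L v = rquot L v'" unfolding rquot eq ..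
  qed
qed

section \<open>Congruences of finite index\<close>

definition saturated :: "'a rel \<Rightarrow> 'a set \<Rightarrow> bool" where
  "saturated R L \<longleftrightarrow> R `` L \<subseteq> L"

lemma saturatedD: "saturated R L \<Longrightarrow> (u, v) \<in> R \<Longrightarrow> u \<in> L \<Longrightarrow> v \<in> L"
  unfolding saturated_def by blast

lemma saturated_iff:
  assumes "equiv UNIV R" "saturated R L" "(u, v) \<in> R"
  shows "u \<in> L \<longleftrightarrow> v \<in> L"
  using saturatedD[OF assms(2)] assms(3) equiv_def[of UNIV R] assms(1) by (meson symE)

lemma saturated_class: "equiv UNIV R \<Longrightarrow> saturated R (R `` {u})"
  unfolding saturated_def equiv_def trans_def by blast

lemma Union_quotient_saturated:
  assumes "equiv UNIV R" "saturated R L"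
  shows "\<Union> (L // R) = L"
proof -
  have "\<Union> (L // R) = R `` L" by (auto simp: quotient_def)
  also have "\<dots> = L"
    using assms unfolding saturated_def equiv_def refl_on_def by blast
  finally show ?thesis .
qed

lemma quotient_mono: "L \<subseteq> K \<Longrightarrow> L // R \<subseteq> K // R"
  by (auto simp: quotient_def)

lemma quotient_UNIV_eq_range: "UNIV // R = range (\<lambda>u. R `` {u})"
  by (simp add: quotient_def UNION_singleton_eq_range)

lemma equiv_Int: "equiv A R \<Longrightarrow> equiv A S \<Longrightarrow> equiv A (R \<inter> S)"
  by (intro equivI) (auto simp: equiv_def refl_on_def sym_Int trans_Int)

lemma finite_quotient_Int:
  assumes "finite (UNIV // R)" "finite (UNIV // S)"
  shows "finite (UNIV // (R \<inter> S))"
  using finite_range_Pair[OF assms[unfolded quotient_UNIV_eq_range]]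
  unfolding quotient_UNIV_eq_range by (rule finite_range_factor) auto

lemma finite_range_respects:
  assumes "equiv UNIV R" "finite (UNIV // R)" "f respects R"
  shows "finite (range f)"
proof (rule finite_range_factor)
  show "finite (range (\<lambda>u. R `` {u}))"
    using assms(2) by (simp add: quotient_UNIV_eq_range)
  show "f u = f v" if "R `` {u} = R `` {v}" for u v
    using assms(3) eq_equiv_class[OF that assms(1)] by (auto simp: congruent_def)
qed

locale finite_congruence =
  fixes R :: "'a list rel"
  assumes equiv: "equiv UNIV R"
    and finite_quotient: "finite (UNIV // R)"
    and append_cong: "(u, u') \<in> R \<Longrightarrow> (v, v') \<in> R \<Longrightarrow> (u @ v, u' @ v') \<in> R"
begin

lemma cong_refl [simp]: "(u, u) \<in> R"
  using equiv by (simp add: equiv_def refl_on_def)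

lemma cong_sym: "(u, v) \<in> R \<Longrightarrow> (v, u) \<in> R"
  using equiv by (auto simp: equiv_def dest: symD)

lemma cong_trans: "(u, v) \<in> R \<Longrightarrow> (v, w) \<in> R \<Longrightarrow> (u, w) \<in> R"
  using equiv by (auto simp: equiv_def dest: transD)

lemma saturated_lquot:
  assumes "saturated R L"
  shows "saturated R (lquot u L)"
  unfolding saturated_def
proof clarsimp
  fix v w assume "(v, w) \<in> R" "u @ v \<in> L"
  then show "u @ w \<in> L" using saturatedD[OF assms append_cong[OF cong_refl]] by blast
qed

lemma saturated_rquot:
  assumes "saturated R L"
  shows "saturated R (rquot L u)"
  unfolding saturated_def
proof clarsimp
  fix v w assume "(v, w) \<in> R" "v @ u \<in> L"
  then show "w @ u \<in> L" using saturatedD[OF assms append_cong[OF _ cong_refl]] by blast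
qed

end

definition same_action :: "'a list set set \<Rightarrow> 'a list rel" where
  "same_action Q = {(u, v). \<forall>q\<in>Q. lquot u q = lquot v q}"

lemma equiv_same_action: "equiv UNIV (same_action Q)"
  by (intro equivI) (auto simp: same_action_def refl_on_def sym_def trans_def)

lemma finite_quotient_same_action:
  assumes "finite Q" "\<And>q. q \<in> Q \<Longrightarrow> finite_index q"
  shows "finite (UNIV // same_action Q)"
proof -
  have "finite (Q \<rightarrow>\<^sub>E (\<Union>q\<in>Q. range (\<lambda>u. lquot u q)))"
    using assms by (intro finite_PiE) (simp_all add: finite_index_def)
  then have "finite (range (\<lambda>u. \<lambda>q\<in>Q. lquot u q))"
    by (rule finite_subset[rotated]) auto
  then have "finite (range (\<lambda>u. same_action Q `` {u}))"
  proof (rule finite_range_factor)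
    fix u v assume "(\<lambda>q\<in>Q. lquot u q) = (\<lambda>q\<in>Q. lquot v q)"
    then have "(u, v) \<in> same_action Q"
      unfolding same_action_def by (simp add: restrict_apply' fun_eq_iff) metis
    then show "same_action Q `` {u} = same_action Q `` {v}"
      by (rule equiv_class_eq[OF equiv_same_action])
  qed
  then show ?thesis by (simp add: quotient_UNIV_eq_range)
qed

locale quotient_algebra =
  fixes D :: "'a list set set"
  assumes empty_mem: "{} \<in> D"
    and Un_mem: "L \<in> D \<Longrightarrow> K \<in> D \<Longrightarrow> L \<union> K \<in> D"
    and Compl_mem: "L \<in> D \<Longrightarrow> - L \<in> D"
    and lquot_mem: "L \<in> D \<Longrightarrow> lquot u L \<in> D"
    and rquot_mem: "L \<in> D \<Longrightarrow> rquot L u \<in> D"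
    and finite_index_mem: "L \<in> D \<Longrightarrow> finite_index L"
begin

lemma Int_mem: "L \<in> D \<Longrightarrow> K \<in> D \<Longrightarrow> L \<inter> K \<in> D"
  using Compl_mem[OF Un_mem[OF Compl_mem Compl_mem]] by simp

lemma UNIV_mem: "UNIV \<in> D"
  using Compl_mem[OF empty_mem] by simp

lemma Union_mem: "finite F \<Longrightarrow> F \<subseteq> D \<Longrightarrow> \<Union> F \<in> D"
  by (induction rule: finite_induct) (auto intro: empty_mem Un_mem)

lemma Inter_mem: "finite F \<Longrightarrow> F \<subseteq> D \<Longrightarrow> \<Inter> F \<in> D"
  by (induction rule: finite_induct) (auto intro: UNIV_mem Int_mem)

lemma nerode_class_mem:
  assumes "L \<in> D"
  shows "{v. lquot u L = lquot v L} \<in> D"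
proof -
  let ?B = "\<lambda>w. if u \<in> rquot L w then rquot L w else - rquot L w"
  have "lquot u L = lquot v L \<longleftrightarrow> (\<forall>w. v \<in> ?B w)" for v
    by (auto simp: set_eq_iff)
  then have "{v. lquot u L = lquot v L} = \<Inter> (range ?B)"
    by blast
  moreover have "finite (range ?B)"
    using finite_range_rquot[OF finite_index_mem[OF assms]] by (rule finite_range_factor) simp
  moreover have "range ?B \<subseteq> D"
    using assms by (auto intro: rquot_mem Compl_mem)
  ultimately show ?thesis by (simp add: Inter_mem)
qed

definition congruence_over :: "'a list rel \<Rightarrow> bool" where
  "congruence_over R \<longleftrightarrow> finite_congruence R \<and> UNIV // R \<subseteq> D"

lemma congruence_over_finite_congruence: "congruence_over R \<Longrightarrow> finite_congruence R"
  by (simp add: congruence_over_def)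

lemma saturated_mem:
  assumes "congruence_over R" "saturated R L"
  shows "L \<in> D"
proof -
  interpret finite_congruence R by (rule congruence_over_finite_congruence[OF assms(1)])
  have "L // R \<subseteq> UNIV // R" by (rule quotient_mono) simp
  then have "\<Union> (L // R) \<in> D"
    using assms(1) finite_quotient
    by (intro Union_mem) (auto simp: congruence_over_def dest: finite_subset)
  then show ?thesis by (simp add: Union_quotient_saturated[OF equiv assms(2)])
qed

lemma congruence_over_same_action:
  assumes "finite Q" "Q \<subseteq> D" "\<And>u q. q \<in> Q \<Longrightarrow> lquot u q \<in> Q"
  shows "congruence_over (same_action Q)"
  unfolding congruence_over_def
proof
  show "finite_congruence (same_action Q)"
  proof
    show "finite (UNIV // same_action Q)"
      using assms(1,2) finite_index_mem by (intro finite_quotient_same_action) auto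
    show "(u @ v, u' @ v') \<in> same_action Q"
      if "(u, u') \<in> same_action Q" "(v, v') \<in> same_action Q" for u u' v v'
      using that assms(3) by (simp add: same_action_def lquot_append)
  qed (rule equiv_same_action)
  show "UNIV // same_action Q \<subseteq> D"
  proof
    fix L assume "L \<in> UNIV // same_action Q"
    then obtain u where "L = same_action Q `` {u}" by (rule quotientE)
    then have "L = \<Inter> ((\<lambda>q. {v. lquot u q = lquot v q}) ` Q)" by (auto simp: same_action_def)
    then show "L \<in> D" using assms(1,2) nerode_class_mem by (auto intro!: Inter_mem)
  qed
qed

lemma ex_saturating_congruence:
  assumes "finite F" "F \<subseteq> D"
  shows "\<exists>R. congruence_over R \<and> (\<forall>L\<in>F. saturated R L)"
proof (intro exI conjI ballI)
  let ?Q = "\<Union>L\<in>F. range (\<lambda>u. lquot u L)"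
  show "congruence_over (same_action ?Q)"
  proof (rule congruence_over_same_action)
    show "finite ?Q" using assms finite_index_mem by (auto simp: finite_index_def)
    show "?Q \<subseteq> D" using assms(2) lquot_mem by auto
    show "lquot u q \<in> ?Q" if "q \<in> ?Q" for u q using that by (auto simp flip: lquot_append) blast
  qed
  show "saturated (same_action ?Q) L" if "L \<in> F" for L
    unfolding saturated_def
  proof clarify
    fix u v assume "u \<in> L" "(u, v) \<in> same_action ?Q"
    moreover have "L \<in> ?Q" using that by (auto intro!: bexI[of _ L] image_eqI[of _ _ "[]"])
    ultimately have "lquot u L = lquot v L" "[] \<in> lquot u L" unfolding same_action_def by auto
    then have "[] \<in> lquot v L" by blast
    then show "v \<in> L" by simp
  qed
qed

lemma ex_saturating_refinement:
  assumes "congruence_over R" "finite F" "F \<subseteq> D"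
  shows "\<exists>S \<subseteq> R. congruence_over S \<and> (\<forall>L\<in>F. saturated S L)"
proof -
  interpret finite_congruence R by (rule congruence_over_finite_congruence[OF assms(1)])
  obtain S where S: "congruence_over S" "\<And>L. L \<in> F \<union> UNIV // R \<Longrightarrow> saturated S L"
    using ex_saturating_congruence[of "F \<union> UNIV // R"] assms finite_quotient
    unfolding congruence_over_def by (metis Un_least finite_Un)
  have "(u, v) \<in> R" if "(u, v) \<in> S" for u v
  proof -
    have "saturated S (R `` {u})" by (rule S(2)) (simp add: quotientI)
    from saturatedD[OF this that] show ?thesis by simp
  qed
  then show ?thesis using S by (intro exI[of _ S]) auto
qed

lemma ex_common_refinement:
  assumes "congruence_over R" "congruence_over S"
  shows "\<exists>T. congruence_over T \<and> T \<subseteq> R \<and> T \<subseteq> S"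
proof -
  interpret S: finite_congruence S by (rule congruence_over_finite_congruence[OF assms(2)])
  obtain T where T: "T \<subseteq> R" "congruence_over T" "\<And>L. L \<in> UNIV // S \<Longrightarrow> saturated T L"
    using ex_saturating_refinement[OF assms(1) S.finite_quotient] assms(2)
    by (auto simp: congruence_over_def)
  have "(u, v) \<in> S" if "(u, v) \<in> T" for u v
    using saturatedD[OF T(3) that, of "S `` {u}"] by (simp add: quotientI)
  then show ?thesis using T by (intro exI[of _ T]) auto
qed

end

lemma prevariety_quotient_algebra: "prevariety C \<Longrightarrow> quotient_algebra C"
  unfolding prevariety_def by unfold_locales (auto intro: regular_finite_index)

section \<open>Recognizable relations\<close>

context quotient_algebra
begin

definition recognizable :: "('a list \<Rightarrow> 'a list \<Rightarrow> bool) \<Rightarrow> bool" where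
  "recognizable P \<longleftrightarrow> (\<exists>R. congruence_over R \<and> P respects2 R)"

lemma recognizable_common_congruence:
  assumes "recognizable P" "recognizable P'"
  obtains R where "congruence_over R" "P respects2 R" "P' respects2 R"
proof -
  obtain R S where "congruence_over R" "P respects2 R" "congruence_over S" "P' respects2 S"
    using assms unfolding recognizable_def by blast
  moreover from this obtain T where "congruence_over T" "T \<subseteq> R" "T \<subseteq> S"
    using ex_common_refinement by blast
  ultimately show thesis using that[of T] unfolding congruent2_def by blast
qed

lemma recognizable_flip: "recognizable (\<lambda>u v. P v u) \<longleftrightarrow> recognizable P"
  unfolding recognizable_def congruent2_def by blast

lemma recognizable_Not: "recognizable P \<Longrightarrow> recognizable (\<lambda>u v. \<not> P u v)"
  unfolding recognizable_def congruent2_def by blast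

lemma recognizable_combine:
  assumes "recognizable P" "recognizable P'"
  shows "recognizable (\<lambda>u v. f (P u v) (P' u v))"
proof -
  obtain R where R: "congruence_over R" "P respects2 R" "P' respects2 R"
    using recognizable_common_congruence[OF assms] .
  have "(\<lambda>u v. f (P u v) (P' u v)) respects2 R"
    by (intro congruent2I' arg_cong2[of _ _ _ _ f] congruent2D[OF R(2)] congruent2D[OF R(3)])
  then show ?thesis using R(1) unfolding recognizable_def by blast
qed

lemmas recognizable_disj = recognizable_combine[of _ _ "(\<or>)"]
lemmas recognizable_conj = recognizable_combine[of _ _ "(\<and>)"]

lemma recognizable_right:
  assumes "L \<in> D"
  shows "recognizable (\<lambda>u v. v \<in> L)"
proof -
  obtain R where R: "congruence_over R" "saturated R L"
    using ex_saturating_congruence[of "{L}"] assms by auto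
  interpret finite_congruence R by (rule congruence_over_finite_congruence[OF R(1)])
  have "(\<lambda>u v. v \<in> L) respects2 R"
    by (rule congruent2I') (rule saturated_iff[OF equiv R(2)])
  then show ?thesis using R(1) unfolding recognizable_def by blast
qed

lemma recognizable_left: "L \<in> D \<Longrightarrow> recognizable (\<lambda>u v. u \<in> L)"
  using recognizable_flip[of "\<lambda>u v. v \<in> L"] recognizable_right by simp

lemma recognizable_context:
  assumes "recognizable P"
  shows "recognizable (\<lambda>u v. P (x @ u) (v @ y))"
proof -
  obtain R where R: "congruence_over R" "P respects2 R"
    using assms unfolding recognizable_def by blast
  then interpret finite_congruence R by (simp add: congruence_over_def)
  have "(\<lambda>u v. P (x @ u) (v @ y)) respects2 R"
    by (intro congruent2I') (auto intro!: congruent2D[OF R(2)] append_cong)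
  then show ?thesis using R(1) unfolding recognizable_def by blast
qed

lemma recognizable_right_section_mem:
  assumes "recognizable P"
  shows "{v. P u v} \<in> D"
proof -
  obtain R where R: "congruence_over R" "P respects2 R"
    using assms unfolding recognizable_def by blast
  then interpret finite_congruence R by (simp add: congruence_over_def)
  have "saturated R {v. P u v}"
    using congruent2D[OF R(2) cong_refl[of u]] unfolding saturated_def by blast
  then show ?thesis by (rule saturated_mem[OF R(1)])
qed

lemma recognizable_left_section_mem: "recognizable P \<Longrightarrow> {u. P u v} \<in> D"
  using recognizable_right_section_mem[OF recognizable_flip[THEN iffD2]] .

lemma recognizableI_sections:
  assumes R: "congruence_over R" "P respects R" and sections: "\<And>u. {v. P u v} \<in> D"
  shows "recognizable P"
proof -
  interpret finite_congruence R by (rule congruence_over_finite_congruence[OF R(1)])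
  have "(\<lambda>u. {v. P u v}) respects R"
    using R(2) by (auto simp: congruent_def)
  then have "finite (range (\<lambda>u. {v. P u v}))"
    by (rule finite_range_respects[OF equiv finite_quotient])
  then obtain S where S: "S \<subseteq> R" "congruence_over S" "\<And>u. saturated S {v. P u v}"
    using ex_saturating_refinement[OF R(1)] sections by (meson image_subsetI rangeI)
  interpret S: finite_congruence S by (rule congruence_over_finite_congruence[OF S(2)])
  have "P respects2 S"
  proof (rule congruent2I')
    fix u u' v v' assume "(u, u') \<in> S" "(v, v') \<in> S"
    then have "P u = P u'" "P u' v \<longleftrightarrow> P u' v'"
      using S(1) R(2) saturated_iff[OF S.equiv S(3)[of u']] by (auto simp: congruent_def)
    then show "P u v = P u' v'" by simp
  qed
  then show ?thesis using S(2) unfolding recognizable_def by blast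
qed

end

locale concatenation_algebra = quotient_algebra D for D :: "'a::finite list set set" +
  assumes letter_mem: "{[a]} \<in> D"
    and conc_mem: "L \<in> D \<Longrightarrow> K \<in> D \<Longrightarrow> conc L K \<in> D"
begin

lemma Nil_mem: "{[]} \<in> D"
proof -
  have "{[]} = lquot [undefined] {[undefined]}" by auto
  then show ?thesis using lquot_mem[OF letter_mem] by metis
qed

lemma recognizable_concatenation_mem:
  assumes "recognizable P"
  shows "{u @ v | u v. P u v} \<in> D"
proof -
  obtain R where R: "congruence_over R" "P respects2 R"
    using assms unfolding recognizable_def by blast
  interpret finite_congruence R by (rule congruence_over_finite_congruence[OF R(1)])
  let ?F = "(\<lambda>(U, V). conc U V) ` {(R `` {u}, R `` {v}) | u v. P u v}"
  have "{u @ v | u v. P u v} = \<Union> ?F"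
  proof (intro equalityI subsetI)
    fix w assume "w \<in> {u @ v | u v. P u v}"
    then obtain u v where "w = u @ v" "P u v" by blast
    moreover have "u @ v \<in> conc (R `` {u}) (R `` {v})"
      unfolding conc_def using cong_refl by blast
    ultimately show "w \<in> \<Union> ?F" by blast
  next
    fix w assume "w \<in> \<Union> ?F"
    then obtain u v where "P u v" "w \<in> conc (R `` {u}) (R `` {v})" by blast
    then obtain u' v' where "w = u' @ v'" "(u, u') \<in> R" "(v, v') \<in> R" by (auto simp: conc_def)
    then show "w \<in> {u @ v | u v. P u v}"
      using congruent2D[OF R(2), of u u' v v'] \<open>P u v\<close> by blast
  qed
  moreover have "{(R `` {u}, R `` {v}) | u v. P u v} \<subseteq> (UNIV // R) \<times> (UNIV // R)"
    by (auto intro: quotientI)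
  then have "finite ?F"
    by (intro finite_imageI)
      (rule finite_subset[OF _ finite_cartesian_product[OF finite_quotient finite_quotient]])
  moreover have "R `` {u} \<in> D" for u
    using R(1) quotientI[of u UNIV R] by (auto simp: congruence_over_def)
  then have "?F \<subseteq> D" by (auto intro: conc_mem)
  ultimately show ?thesis by (simp add: Union_mem)
qed

lemma all_splits_mem:
  assumes "recognizable P"
  shows "{x. \<forall>u v. x = u @ v \<longrightarrow> P u v} \<in> D"
proof -
  have "{x. \<forall>u v. x = u @ v \<longrightarrow> P u v} = - {u @ v | u v. \<not> P u v}" by blast
  then show ?thesis
    using Compl_mem[OF recognizable_concatenation_mem[OF recognizable_Not[OF assms]]] by simp
qed

context
  fixes R :: "'a list rel" and M :: "'a list \<Rightarrow> 'a list \<Rightarrow> 'a list set"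
  assumes R: "congruence_over R" "M respects2 R" and M: "\<And>u v. M u v \<in> D"
begin

interpretation finite_congruence R
  by (rule congruence_over_finite_congruence[OF R(1)])

lemma recognizable_ex_prefix: "recognizable (\<lambda>u w. \<exists>x v. w = x @ v \<and> x \<in> M u v)"
proof (rule recognizableI_sections[OF R(1)])
  show "(\<lambda>u w. \<exists>x v. w = x @ v \<and> x \<in> M u v) respects R"
    using congruent2D[OF R(2) _ cong_refl] by (fastforce simp: congruent_def)
  fix u
  have "recognizable (\<lambda>v x. x \<in> M u v)"
    by (rule recognizableI_sections[OF R(1)])
      (auto simp: congruent_def M congruent2D[OF R(2) cong_refl])
  then have "recognizable (\<lambda>x v. x \<in> M u v)" by (subst recognizable_flip)
  from recognizable_concatenation_mem[OF this]
  show "{w. \<exists>x v. w = x @ v \<and> x \<in> M u v} \<in> D" .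
qed

lemma recognizable_ex_suffix: "recognizable (\<lambda>w v. \<exists>u x. w = u @ x \<and> x \<in> M u v)"
proof (subst recognizable_flip[symmetric], rule recognizableI_sections[OF R(1)])
  show "(\<lambda>v w. \<exists>u x. w = u @ x \<and> x \<in> M u v) respects R"
    using congruent2D[OF R(2) cong_refl] by (fastforce simp: congruent_def)
  fix v
  have "recognizable (\<lambda>u x. x \<in> M u v)"
    by (rule recognizableI_sections[OF R(1)])
      (auto simp: congruent_def M congruent2D[OF R(2) _ cong_refl])
  from recognizable_concatenation_mem[OF this]
  show "{w. \<exists>u x. w = u @ x \<and> x \<in> M u v} \<in> D" .
qed

end

end

section \<open>From temporal formulas to star-free expressions\<close>

text \<open>A factorization \<open>u @ v\<close> cuts a word between the positions \<open>length u\<close> and \<open>Suc (length u)\<close>.\<close>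

definition sat_before :: "'a ltlp \<Rightarrow> 'a list \<Rightarrow> 'a list \<Rightarrow> bool" where
  "sat_before \<phi> u v \<longleftrightarrow> sat (u @ v) (length u) \<phi>"

definition sat_after :: "'a ltlp \<Rightarrow> 'a list \<Rightarrow> 'a list \<Rightarrow> bool" where
  "sat_after \<phi> u v \<longleftrightarrow> sat (u @ v) (Suc (length u)) \<phi>"

lemma sat_after_Cons: "sat_after \<phi> u (a # v) \<longleftrightarrow> sat_before \<phi> (u @ [a]) v"
  by (simp add: sat_after_def sat_before_def)

lemma sat_between_iff:
  "(\<forall>k. length u < k \<and> k < Suc (length u + length x) \<longrightarrow> P k) \<longleftrightarrow>
    (\<forall>y z. x = y @ z \<longrightarrow> z \<noteq> [] \<longrightarrow> P (Suc (length u + length y)))"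
proof (intro iffI allI impI)
  fix k
  assume splits: "\<forall>y z. x = y @ z \<longrightarrow> z \<noteq> [] \<longrightarrow> P (Suc (length u + length y))"
    and k: "length u < k \<and> k < Suc (length u + length x)"
  let ?i = "k - Suc (length u)"
  have "?i < length x" "k = Suc (length u + length (take ?i x))" using k by auto
  then show "P k" using splits[rule_format, of "take ?i x" "drop ?i x"] by simp
qed auto

definition holding_inside :: "('a list \<Rightarrow> 'a list \<Rightarrow> bool) \<Rightarrow> 'a list \<Rightarrow> 'a list \<Rightarrow> 'a list set" where
  "holding_inside P u v = {x. \<forall>y z. x = y @ z \<longrightarrow> z \<noteq> [] \<longrightarrow> P (u @ y) (z @ v)}"

lemma holding_inside_sat_after_iff:
  "x \<in> holding_inside (sat_after \<phi>) u v \<longleftrightarrow>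
    (\<forall>k. length u < k \<and> k < Suc (length u + length x) \<longrightarrow> sat (u @ x @ v) k \<phi>)"
  unfolding sat_between_iff by (auto simp: holding_inside_def sat_after_def)

definition until_relation :: "'a list set \<Rightarrow> ('a list \<Rightarrow> 'a list \<Rightarrow> bool) \<Rightarrow>
    ('a list \<Rightarrow> 'a list \<Rightarrow> bool) \<Rightarrow> 'a list \<Rightarrow> 'a list \<Rightarrow> bool" where
  "until_relation L P S u w \<longleftrightarrow>
    (\<exists>x v. w = x @ v \<and> x \<in> L \<inter> holding_inside P u v \<inter> {x. S (u @ x) v})"

definition since_relation :: "'a list set \<Rightarrow> ('a list \<Rightarrow> 'a list \<Rightarrow> bool) \<Rightarrow>
    ('a list \<Rightarrow> 'a list \<Rightarrow> bool) \<Rightarrow> 'a list \<Rightarrow> 'a list \<Rightarrow> bool" where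
  "since_relation L P S w v \<longleftrightarrow>
    (\<exists>u x. w = u @ x \<and> x \<in> L \<inter> holding_inside P u v \<inter> {x. S u (x @ v)})"

lemma sat_before_Until: "sat_before (Until L \<phi> \<psi>) = until_relation L (sat_after \<phi>) (sat_after \<psi>)"
proof (intro ext)
  fix u w
  let ?M = "\<lambda>v. L \<inter> holding_inside (sat_after \<phi>) u v \<inter> {x. sat_after \<psi> (u @ x) v}"
  let ?S = "\<lambda>j. infx (u @ w) (length u) j \<in> L \<and> sat (u @ w) j \<psi> \<and>
    (\<forall>k. length u < k \<and> k < j \<longrightarrow> sat (u @ w) k \<phi>)"
  have split: "?S (Suc (length u + length x)) \<longleftrightarrow> x \<in> ?M v" if "w = x @ v" for x v
    using that by (auto simp: infx_def holding_inside_sat_after_iff sat_after_def)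
  show "sat_before (Until L \<phi> \<psi>) u w \<longleftrightarrow> until_relation L (sat_after \<phi>) (sat_after \<psi>) u w"
    unfolding until_relation_def
  proof
    assume "sat_before (Until L \<phi> \<psi>) u w"
    then obtain j where j: "length u < j" "j \<le> Suc (length (u @ w))" "?S j"
      by (auto simp: sat_before_def)
    let ?i = "j - Suc (length u)"
    have "j = Suc (length u + length (take ?i w))" using j(1,2) by simp
    then have "take ?i w \<in> ?M (drop ?i w)"
      using j(3) split[of "take ?i w" "drop ?i w"] by simp
    then show "\<exists>x v. w = x @ v \<and> x \<in> ?M v" by (metis append_take_drop_id)
  next
    assume "\<exists>x v. w = x @ v \<and> x \<in> ?M v"
    then obtain x v where "w = x @ v" "?S (Suc (length u + length x))" using split by blast
    then show "sat_before (Until L \<phi> \<psi>) u w"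
      unfolding sat_before_def sat.simps by (intro exI[of _ "Suc (length u + length x)"]) simp
  qed
qed

lemma sat_after_Since: "sat_after (Since L \<phi> \<psi>) = since_relation L (sat_after \<phi>) (sat_before \<psi>)"
proof (intro ext)
  fix w v
  let ?M = "\<lambda>u. L \<inter> holding_inside (sat_after \<phi>) u v \<inter> {x. sat_before \<psi> u (x @ v)}"
  let ?S = "\<lambda>j. infx (w @ v) j (Suc (length w)) \<in> L \<and> sat (w @ v) j \<psi> \<and>
    (\<forall>k. j < k \<and> k < Suc (length w) \<longrightarrow> sat (w @ v) k \<phi>)"
  have split: "?S (length u) \<longleftrightarrow> x \<in> ?M u" if "w = u @ x" for u x
    using that by (auto simp: infx_def holding_inside_sat_after_iff sat_before_def)
  show "sat_after (Since L \<phi> \<psi>) w v \<longleftrightarrow> since_relation L (sat_after \<phi>) (sat_before \<psi>) w v"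
    unfolding since_relation_def
  proof
    assume "sat_after (Since L \<phi> \<psi>) w v"
    then obtain j where j: "j < Suc (length w)" "?S j" by (auto simp: sat_after_def)
    then have "drop j w \<in> ?M (take j w)"
      using split[of "take j w" "drop j w"] by (simp add: min_absorb2)
    then show "\<exists>u x. w = u @ x \<and> x \<in> ?M u" by (metis append_take_drop_id)
  next
    assume "\<exists>u x. w = u @ x \<and> x \<in> ?M u"
    then obtain u x where "w = u @ x" "?S (length u)" using split by blast
    then show "sat_after (Since L \<phi> \<psi>) w v"
      unfolding sat_after_def sat.simps by (intro exI[of _ "length u"]) simp
  qed
qed

context concatenation_algebra
begin

lemma letters_mem: "range (\<lambda>a. [a]) \<in> D"
proof -
  have "\<Union> (range (\<lambda>a. {[a]})) \<in> D" by (rule Union_mem) (auto intro: letter_mem)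
  then show ?thesis by (simp add: UNION_singleton_eq_range)
qed

lemma holding_inside_mem:
  assumes "recognizable P"
  shows "holding_inside P u v \<in> D"
proof -
  have "{x. \<forall>y z. x = y @ z \<longrightarrow> z \<in> {[]} \<or> P (u @ y) (z @ v)} \<in> D"
    by (intro all_splits_mem recognizable_disj recognizable_right Nil_mem
        recognizable_context assms)
  moreover have "{x. \<forall>y z. x = y @ z \<longrightarrow> z \<in> {[]} \<or> P (u @ y) (z @ v)} = holding_inside P u v"
    by (auto simp: holding_inside_def)
  ultimately show ?thesis by simp
qed

lemma
  assumes L: "L \<in> D" and P: "recognizable P" and S: "recognizable S"
  shows recognizable_until_relation: "recognizable (until_relation L P S)"
    and recognizable_since_relation: "recognizable (since_relation L P S)"
proof -
  obtain R where R: "congruence_over R" "P respects2 R" "S respects2 R"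
    using recognizable_common_congruence[OF P S] .
  interpret finite_congruence R by (rule congruence_over_finite_congruence[OF R(1)])
  have cong: "holding_inside P u v = holding_inside P u' v'"
      "S (u @ x) v = S (u' @ x) v'" "S u (x @ v) = S u' (x @ v')"
    if "(u, u') \<in> R" "(v, v') \<in> R" for u u' v v' x
  proof -
    have "P (u @ y) (z @ v) = P (u' @ y) (z @ v')" for y z
      using that by (auto intro!: congruent2D[OF R(2)] append_cong)
    then show "holding_inside P u v = holding_inside P u' v'"
      by (simp add: holding_inside_def)
  qed (use that in \<open>auto intro!: congruent2D[OF R(3)] append_cong\<close>)
  show "recognizable (until_relation L P S)"
    unfolding until_relation_def[abs_def]
  proof (rule recognizable_ex_prefix[OF R(1)])
    show "(\<lambda>u v. L \<inter> holding_inside P u v \<inter> {x. S (u @ x) v}) respects2 R"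
      by (rule congruent2I') (simp add: cong)
    show "L \<inter> holding_inside P u v \<inter> {x. S (u @ x) v} \<in> D" for u v
      using recognizable_left_section_mem[OF recognizable_context[OF S, of u "[]"], of v]
      by (simp add: Int_mem holding_inside_mem L P)
  qed
  show "recognizable (since_relation L P S)"
    unfolding since_relation_def[abs_def]
  proof (rule recognizable_ex_suffix[OF R(1)])
    show "(\<lambda>u v. L \<inter> holding_inside P u v \<inter> {x. S u (x @ v)}) respects2 R"
      by (rule congruent2I') (simp add: cong)
    show "L \<inter> holding_inside P u v \<inter> {x. S u (x @ v)} \<in> D" for u v
      using recognizable_right_section_mem[OF recognizable_context[OF S, of "[]" v], of u]
      by (simp add: Int_mem holding_inside_mem L P)
  qed
qed

lemma recognizable_True: "recognizable (\<lambda>_ _. True)"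
  using recognizable_right[OF UNIV_mem] by simp

lemma recognizable_sat_after:
  assumes "recognizable (sat_before \<phi>)" "\<And>u. \<not> sat_after \<phi> u []"
  shows "recognizable (sat_after \<phi>)"
proof -
  have "sat_after \<phi> = until_relation (range (\<lambda>a. [a])) (\<lambda>_ _. True) (sat_before \<phi>)"
  proof (intro ext)
    fix u w
    show "sat_after \<phi> u w \<longleftrightarrow> until_relation (range (\<lambda>a. [a])) (\<lambda>_ _. True) (sat_before \<phi>) u w"
    proof (cases w)
      case (Cons a v)
      then show ?thesis
        by (auto simp: until_relation_def sat_after_Cons holding_inside_def)
          (intro exI[of _ "[a]"] exI[of _ v], simp)
    qed (use assms(2) in \<open>auto simp: until_relation_def\<close>)
  qed
  then show ?thesis
    using recognizable_until_relation[OF letters_mem recognizable_True assms(1)] by simp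
qed

lemma recognizable_sat_before:
  assumes "recognizable (sat_after \<phi>)" "\<And>v. \<not> sat_before \<phi> [] v"
  shows "recognizable (sat_before \<phi>)"
proof -
  have "sat_before \<phi> = since_relation (range (\<lambda>a. [a])) (\<lambda>_ _. True) (sat_after \<phi>)"
  proof (intro ext)
    fix w v
    show "sat_before \<phi> w v \<longleftrightarrow> since_relation (range (\<lambda>a. [a])) (\<lambda>_ _. True) (sat_after \<phi>) w v"
    proof (cases w rule: rev_cases)
      case (snoc u a)
      then show ?thesis
        by (auto simp: since_relation_def sat_after_Cons holding_inside_def)
          (intro exI[of _ u] exI[of _ "[a]"], simp add: sat_after_Cons)
    qed (use assms(2) in \<open>auto simp: since_relation_def\<close>)
  qed
  then show ?thesis
    using recognizable_since_relation[OF letters_mem recognizable_True assms(1)] by simp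
qed

lemma recognizable_Lab: "recognizable (sat_before (Lab a)) \<and> recognizable (sat_after (Lab a))"
proof -
  have "sat_before (Lab a) = (\<lambda>u v. u \<in> conc UNIV {[a]})"
  proof (intro ext)
    fix u v
    show "sat_before (Lab a) u v \<longleftrightarrow> u \<in> conc UNIV {[a]}"
      by (cases u rule: rev_cases) (auto simp: sat_before_def conc_def)
  qed
  then have "recognizable (sat_before (Lab a))"
    by (simp only: recognizable_left conc_mem letter_mem UNIV_mem)
  moreover have "\<not> sat_after (Lab a) u []" for u by (simp add: sat_after_def)
  ultimately show ?thesis using recognizable_sat_after by blast
qed

lemma recognizable_Until:
  assumes "L \<in> D" "recognizable (sat_after \<phi>)" "recognizable (sat_after \<psi>)"
  shows "recognizable (sat_before (Until L \<phi> \<psi>)) \<and> recognizable (sat_after (Until L \<phi> \<psi>))"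
proof -
  have "recognizable (sat_before (Until L \<phi> \<psi>))"
    unfolding sat_before_Until by (rule recognizable_until_relation[OF assms])
  moreover have "\<not> sat_after (Until L \<phi> \<psi>) u []" for u by (auto simp: sat_after_def)
  ultimately show ?thesis using recognizable_sat_after by blast
qed

lemma recognizable_Since:
  assumes "L \<in> D" "recognizable (sat_after \<phi>)" "recognizable (sat_before \<psi>)"
  shows "recognizable (sat_before (Since L \<phi> \<psi>)) \<and> recognizable (sat_after (Since L \<phi> \<psi>))"
proof -
  have "recognizable (sat_after (Since L \<phi> \<psi>))"
    unfolding sat_after_Since by (rule recognizable_since_relation[OF assms])
  moreover have "\<not> sat_before (Since L \<phi> \<psi>) [] v" for v by (simp add: sat_before_def)
  ultimately show ?thesis using recognizable_sat_before by blast
qed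

lemma recognizable_formula:
  assumes "mlangs \<phi> \<subseteq> D"
  shows "recognizable (sat_before \<phi>) \<and> recognizable (sat_after \<phi>)"
proof -
  note sat_defs = sat_before_def[abs_def] sat_after_def[abs_def]
  show ?thesis
    using assms
  proof (induction \<phi>)
    case TT
    show ?case using recognizable_True by (simp add: sat_defs)
  next
    case Min
    show ?case
      using recognizable_left[OF Nil_mem] recognizable_left[OF empty_mem] by (simp add: sat_defs)
  next
    case Max
    show ?case
      using recognizable_right[OF Nil_mem] recognizable_right[OF empty_mem] by (simp add: sat_defs)
  next
    case (Or \<phi> \<psi>)
    then show ?case
      using recognizable_disj[of "sat_before \<phi>" "sat_before \<psi>"]
        recognizable_disj[of "sat_after \<phi>" "sat_after \<psi>"] by (simp add: sat_defs)
  next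
    case (And \<phi> \<psi>)
    then show ?case
      using recognizable_conj[of "sat_before \<phi>" "sat_before \<psi>"]
        recognizable_conj[of "sat_after \<phi>" "sat_after \<psi>"] by (simp add: sat_defs)
  next
    case (Neg \<phi>)
    then show ?case
      using recognizable_Not[of "sat_before \<phi>"] recognizable_Not[of "sat_after \<phi>"]
      by (simp add: sat_defs)
  qed (simp_all add: recognizable_Lab recognizable_Until recognizable_Since)
qed

lemma lang_of_mem:
  assumes "mlangs \<phi> \<subseteq> D"
  shows "lang_of \<phi> \<in> D"
proof -
  have "lang_of \<phi> = {w. sat_before \<phi> [] w}" by (simp add: lang_of_def sat_before_def)
  then show ?thesis using recognizable_formula[OF assms] recognizable_right_section_mem by simp
qed

end

section \<open>The star-free closure as an algebra of languages\<close>

lemma SF_UNIV: "UNIV \<in> SF C"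
proof -
  have "{[undefined]} \<union> - {[undefined]} \<in> SF C" by (intro SF.intros)
  then show ?thesis by (simp only: Compl_partition)
qed

lemma SF_empty: "{} \<in> SF C"
  using SF.SF_compl[OF SF_UNIV] by simp

lemma SF_Union: "finite F \<Longrightarrow> F \<subseteq> SF C \<Longrightarrow> \<Union> F \<in> SF C"
  by (induction rule: finite_induct) (auto intro: SF_empty SF.SF_union)

lemma SF_Nil: "{[]} \<in> SF C"
proof -
  have "\<Union> (range (\<lambda>a. conc {[a]} UNIV)) \<in> SF C"
    by (rule SF_Union) (auto intro: SF.intros SF_UNIV)
  moreover have "- \<Union> (range (\<lambda>a. conc {[a]} UNIV)) = {[]}"
    by (auto simp: conc_def) (metis neq_Nil_conv)
  ultimately show ?thesis using SF.SF_compl by metis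
qed

lemma finite_tail_lquots: "finite (tail_lquots L K u)"
proof (rule finite_subset)
  show "tail_lquots L K u \<subseteq> (\<lambda>v. lquot v K) ` set (suffixes u)"
    by (auto simp: tail_lquots_def suffix_def)
qed simp

lemma SF_lquot:
  assumes "\<And>L u. L \<in> C \<Longrightarrow> lquot u L \<in> C" and "L \<in> SF C"
  shows "lquot u L \<in> SF C"
  using assms(2)
proof (induction arbitrary: u rule: SF.induct)
  case (SF_base L)
  then show ?case by (intro SF.SF_base assms(1))
next
  case (SF_letter a)
  consider "lquot u {[a]} = {[a]}" | "lquot u {[a]} = {[]}" | "lquot u {[a]} = {}"
    by (cases u) (auto simp: lquot_def)
  then show ?case by cases (simp_all only: SF_Nil SF_empty SF.SF_letter)
next
  case (SF_conc L K)
  have "\<Union> (tail_lquots L K u) \<in> SF C"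
    by (rule SF_Union[OF finite_tail_lquots]) (auto simp: tail_lquots_def SF_conc.IH(2))
  then show ?case unfolding lquot_conc by (intro SF.SF_union SF.SF_conc SF_conc)
qed (simp_all add: lquot_Un lquot_Compl SF.SF_union SF.SF_compl)

lemma mem_image_rev_iff: "w \<in> rev ` L \<longleftrightarrow> rev w \<in> L"
  by (metis image_iff rev_rev_ident)

lemma SF_image_rev: "L \<in> SF C \<Longrightarrow> rev ` L \<in> SF ((`) rev ` C)"
proof (induction rule: SF.induct)
  case (SF_conc L K)
  have "rev ` conc L K = conc (rev ` K) (rev ` L)"
    by (auto simp: conc_def image_iff) (metis rev_append)+
  then show ?case using SF_conc.IH by (simp add: SF.SF_conc)
next
  case (SF_compl L)
  have "rev ` (- L) = - rev ` L" by (auto simp: mem_image_rev_iff)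
  then show ?case using SF_compl.IH by (simp add: SF.SF_compl)
qed (auto simp: image_Un intro: SF.intros)

lemma rquot_eq_image_rev: "rquot L u = rev ` lquot (rev u) (rev ` L)"
  by (auto simp: mem_image_rev_iff)

lemma lquot_image_rev: "lquot u (rev ` L) = rev ` rquot L (rev u)"
  by (simp add: rquot_eq_image_rev image_comp)

lemma SF_rquot:
  assumes "\<And>L u. L \<in> C \<Longrightarrow> rquot L u \<in> C" and "L \<in> SF C"
  shows "rquot L u \<in> SF C"
proof -
  have "lquot (rev u) (rev ` L) \<in> SF ((`) rev ` C)"
    by (rule SF_lquot) (auto simp: lquot_image_rev intro: assms SF_image_rev)
  from SF_image_rev[OF this] show ?thesis
    by (simp add: rquot_eq_image_rev image_comp)
qed

lemma SF_finite_index: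
  assumes "\<And>L. L \<in> C \<Longrightarrow> finite_index L" and "L \<in> SF C"
  shows "finite_index L"
  using assms(2)
  by (induction rule: SF.induct)
    (auto intro: assms(1) finite_index_finite finite_index_Un finite_index_Compl finite_index_conc)

lemma concatenation_algebra_SF:
  assumes "prevariety C"
  shows "concatenation_algebra (SF C)"
proof -
  interpret quotient_algebra C by (rule prevariety_quotient_algebra[OF assms])
  show ?thesis
    by unfold_locales (auto intro: SF.intros SF_empty SF_lquot SF_rquot SF_finite_index
        lquot_mem rquot_mem finite_index_mem)
qed

lemma LTLP_subset_SF:
  assumes "prevariety C"
  shows "LTLP C \<subseteq> SF C"
proof -
  interpret concatenation_algebra "SF C" by (rule concatenation_algebra_SF[OF assms])
  have "C \<subseteq> SF C" by (auto intro: SF.SF_base)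
  then show ?thesis by (auto simp: LTLP_def intro!: lang_of_mem)
qed

section \<open>Languages definable with until\<close>

definition until_lang :: "'b list set \<Rightarrow> 'b list set \<Rightarrow> 'b list set \<Rightarrow> 'b list set" where
  "until_lang M P T = {x @ v | x v. x \<in> M \<and> v \<in> T \<and> (\<forall>y z. x = y @ z \<longrightarrow> z \<noteq> [] \<longrightarrow> z @ v \<in> P)}"

lemma until_lang_Nil: "[] \<in> until_lang M P T \<longleftrightarrow> [] \<in> M \<and> [] \<in> T"
  by (auto simp: until_lang_def)

lemma until_lang_Cons:
  "a # w \<in> until_lang M P T \<longleftrightarrow>
    [] \<in> M \<and> a # w \<in> T \<or> a # w \<in> P \<and> w \<in> until_lang (lquot [a] M) P T"
proof
  assume "a # w \<in> until_lang M P T"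
  then obtain x v where x: "a # w = x @ v" "x \<in> M" "v \<in> T"
      "\<And>y z. x = y @ z \<Longrightarrow> z \<noteq> [] \<Longrightarrow> z @ v \<in> P"
    by (auto simp: until_lang_def)
  show "[] \<in> M \<and> a # w \<in> T \<or> a # w \<in> P \<and> w \<in> until_lang (lquot [a] M) P T"
  proof (cases x)
    case (Cons b x')
    have "z @ v \<in> P" if "x' = y @ z" "z \<noteq> []" for y z
      using x(4)[of "b # y" z] Cons that by simp
    then have "w \<in> until_lang (lquot [a] M) P T"
      using x(1-3) Cons by (auto simp: until_lang_def)
    then show ?thesis using x(1) x(4)[of "[]" x] Cons by simp
  qed (use x in simp)
next
  assume "[] \<in> M \<and> a # w \<in> T \<or> a # w \<in> P \<and> w \<in> until_lang (lquot [a] M) P T"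
  then show "a # w \<in> until_lang M P T"
  proof
    assume "a # w \<in> P \<and> w \<in> until_lang (lquot [a] M) P T"
    then obtain x v where x: "a # w \<in> P" "w = x @ v" "a # x \<in> M" "v \<in> T"
        "\<And>y z. x = y @ z \<Longrightarrow> z \<noteq> [] \<Longrightarrow> z @ v \<in> P"
      by (auto simp: until_lang_def)
    have "z @ v \<in> P" if "a # x = y @ z" "z \<noteq> []" for y z
      using that x(1,2,5) by (cases y) auto
    then show ?thesis
      unfolding until_lang_def using x(2-4) by (intro CollectI exI[of _ "a # x"] exI[of _ v]) simp
  qed (auto simp: until_lang_def)
qed

lemma until_lang_subset: "until_lang M P T \<subseteq> P \<union> T"
proof
  fix w assume "w \<in> until_lang M P T"
  then show "w \<in> P \<union> T" by (cases w) (auto simp: until_lang_Nil until_lang_Cons)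
qed

lemma lquot_UNIV: "lquot u UNIV = UNIV"
  by auto

lemma lquot_vimage_concat: "lquot u (concat -` L) = concat -` lquot (concat u) L"
  by auto

lemma Cons_mem_set_Cons: "x # w \<in> set_Cons A P \<longleftrightarrow> x \<in> A \<and> w \<in> P"
  by (auto simp: set_Cons_def)

lemma Nil_notin_set_Cons: "[] \<notin> set_Cons A P"
  by (auto simp: set_Cons_def)

lemmas until_lang_simps = until_lang_Nil until_lang_Cons lquot_UNIV lquot_vimage_concat
  Cons_mem_set_Cons Nil_notin_set_Cons

text \<open>Letters are words over the original alphabet, so that all alphabets arising in the induction
  below share one type; they may be infinite, but only \<open>S\<close>-saturated sets of letters can be tested.\<close>

inductive_set ltl_langs :: "'a list rel \<Rightarrow> 'a list rel \<Rightarrow> 'a list set \<Rightarrow> 'a list list set set"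
  for R S X where
  ltl_empty: "{} \<in> ltl_langs R S X"
| ltl_Un: "P \<in> ltl_langs R S X \<Longrightarrow> T \<in> ltl_langs R S X \<Longrightarrow> P \<union> T \<in> ltl_langs R S X"
| ltl_compl: "P \<in> ltl_langs R S X \<Longrightarrow> lists X - P \<in> ltl_langs R S X"
| ltl_Cons: "saturated S E \<Longrightarrow> P \<in> ltl_langs R S X \<Longrightarrow> set_Cons (E \<inter> X) P \<in> ltl_langs R S X"
| ltl_until: "saturated R L \<Longrightarrow> P \<in> ltl_langs R S X \<Longrightarrow> T \<in> ltl_langs R S X \<Longrightarrow>
    until_lang (concat -` L) P T \<in> ltl_langs R S X"

lemma ltl_subset_lists: "P \<in> ltl_langs R S X \<Longrightarrow> P \<subseteq> lists X"
proof (induction rule: ltl_langs.induct)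
  case (ltl_until L P T)
  then show ?case using until_lang_subset[of _ P T] by blast
next
  case (ltl_Cons E P)
  show ?case
  proof
    fix w assume "w \<in> set_Cons (E \<inter> X) P"
    then obtain x v where "w = x # v" "x \<in> X" "v \<in> P" by (auto simp: set_Cons_def)
    then show "w \<in> lists X" using ltl_Cons.IH by auto
  qed
qed auto

lemma ltl_lists: "lists X \<in> ltl_langs R S X"
  using ltl_compl[OF ltl_empty] by simp

lemma ltl_Int:
  assumes "P \<in> ltl_langs R S X" "T \<in> ltl_langs R S X"
  shows "P \<inter> T \<in> ltl_langs R S X"
proof -
  have "P \<inter> T = lists X - ((lists X - P) \<union> (lists X - T))"
    using assms[THEN ltl_subset_lists] by blast
  then show ?thesis using assms by (simp only: ltl_compl ltl_Un)
qed

lemma ltl_Diff: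
  assumes "P \<in> ltl_langs R S X" "T \<in> ltl_langs R S X"
  shows "P - T \<in> ltl_langs R S X"
proof -
  have "P - T = P \<inter> (lists X - T)" using assms[THEN ltl_subset_lists] by blast
  then show ?thesis using assms by (simp only: ltl_compl ltl_Int)
qed

lemma ltl_UN:
  assumes "finite A" "\<And>a. a \<in> A \<Longrightarrow> P a \<in> ltl_langs R S X"
  shows "(\<Union>a\<in>A. P a) \<in> ltl_langs R S X"
  using assms by (induction rule: finite_induct) (auto intro: ltl_empty ltl_Un)

lemma ltl_Ball:
  assumes "finite A" "\<And>a. a \<in> A \<Longrightarrow> {w \<in> lists X. P a w} \<in> ltl_langs R S X"
  shows "{w \<in> lists X. \<forall>a\<in>A. P a w} \<in> ltl_langs R S X"
proof -
  have "{w \<in> lists X. \<forall>a\<in>A. P a w} = lists X - (\<Union>a\<in>A. lists X - {w \<in> lists X. P a w})"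
    by blast
  also have "\<dots> \<in> ltl_langs R S X" by (intro ltl_compl ltl_UN assms)
  finally show ?thesis .
qed

lemma saturated_UNIV: "saturated R UNIV"
  by (simp add: saturated_def)

lemma ltl_until_UNIV:
  "P \<in> ltl_langs R S X \<Longrightarrow> T \<in> ltl_langs R S X \<Longrightarrow> until_lang UNIV P T \<in> ltl_langs R S X"
  using ltl_until[OF saturated_UNIV] by simp

lemma ltl_Nil: "{[]} \<in> ltl_langs R S X"
proof -
  have "w \<in> {[]} \<longleftrightarrow> w \<in> lists X - set_Cons (UNIV \<inter> X) (lists X)" for w
    by (cases w) (auto simp: Cons_mem_set_Cons Nil_notin_set_Cons)
  then have "{[]} = lists X - set_Cons (UNIV \<inter> X) (lists X)" by blast
  then show ?thesis by (simp only: ltl_compl ltl_Cons ltl_lists saturated_UNIV)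
qed

lemma ltl_concat:
  assumes "saturated R L"
  shows "{w \<in> lists X. concat w \<in> L} \<in> ltl_langs R S X"
proof -
  have "w \<in> until_lang (concat -` K) (lists X) {[]} \<longleftrightarrow> w \<in> lists X \<and> concat w \<in> K" for w K
    by (induction w arbitrary: K) (auto simp: until_lang_simps)
  then have "{w \<in> lists X. concat w \<in> L} = until_lang (concat -` L) (lists X) {[]}" by blast
  then show ?thesis using ltl_until[OF assms ltl_lists ltl_Nil] by simp
qed

subsection \<open>Splitting at marked letters\<close>

abbreviation before_mark :: "'b set \<Rightarrow> 'b list \<Rightarrow> 'b list" where
  "before_mark E \<equiv> takeWhile (\<lambda>x. x \<notin> E)"

abbreviation from_mark :: "'b set \<Rightarrow> 'b list \<Rightarrow> 'b list" where
  "from_mark E \<equiv> dropWhile (\<lambda>x. x \<notin> E)"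

primrec unmarked_suffix :: "'b set \<Rightarrow> 'b list \<Rightarrow> 'b list" where
  "unmarked_suffix E [] = []"
| "unmarked_suffix E (x # w) =
    (if x \<in> E \<or> set w \<inter> E \<noteq> {} then unmarked_suffix E w else x # w)"

lemma before_mark_lists: "w \<in> lists X \<Longrightarrow> before_mark E w \<in> lists (X - E)"
  by (auto simp: in_lists_conv_set dest: set_takeWhileD)

lemma from_mark_ConsD:
  "from_mark E w = e # r \<Longrightarrow> w \<in> lists X \<Longrightarrow> e \<in> E \<inter> X \<and> r \<in> lists X"
  by (induction w) (auto split: if_splits)

lemma split_at_mark_until_lang_iff:
  fixes X E :: "'b set"
  assumes T: "T \<subseteq> set_Cons (E \<inter> X) (lists X)"
  shows "w \<in> lists X \<and> before_mark E w \<in> until_lang M P Q \<and> from_mark E w \<in> T \<longleftrightarrow>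
    w \<in> until_lang M
      ({w \<in> lists X. before_mark E w \<in> P \<and> from_mark E w \<in> T} - set_Cons (E \<inter> X) (lists X))
      {w \<in> lists X. before_mark E w \<in> Q \<and> from_mark E w \<in> T}"
proof (induction w arbitrary: M)
  case (Cons x w)
  show ?case
  proof (cases "x \<in> E")
    case True
    then show ?thesis by (auto simp: until_lang_simps)
  next
    case False
    then show ?thesis using Cons.IH[of "lquot [x] M"] by (auto simp: until_lang_simps)
  qed
qed (use T in \<open>auto simp: until_lang_simps\<close>)

lemma unmarked_suffix_lists: "w \<in> lists X \<Longrightarrow> unmarked_suffix E w \<in> lists (X - E)"
  by (induction w) auto

context
  fixes R S :: "'a list rel" and X E :: "'a list set"
  assumes E: "saturated S E"
begin

lemma ltl_marked: "P \<in> ltl_langs R S X \<Longrightarrow> set_Cons (E \<inter> X) P \<in> ltl_langs R S X"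
  by (rule ltl_Cons[OF E])

lemma ltl_unmarked: "lists X - set_Cons (E \<inter> X) (lists X) \<in> ltl_langs R S X"
  by (intro ltl_compl ltl_marked ltl_lists)

lemma ltl_from_mark:
  assumes T: "T \<in> ltl_langs R S X" "T \<subseteq> set_Cons (E \<inter> X) (lists X)"
  shows "{w \<in> lists X. from_mark E w \<in> T} \<in> ltl_langs R S X"
proof -
  let ?N = "lists X - set_Cons (E \<inter> X) (lists X)"
  have start: "[] \<notin> T" "x # w \<in> T \<Longrightarrow> x \<in> E \<inter> X \<and> w \<in> lists X" for x w
    using T(2) by (auto simp: set_Cons_def simp del: in_lists_conv_set)
  have "w \<in> until_lang UNIV ?N T \<longleftrightarrow> w \<in> lists X \<and> from_mark E w \<in> T" for w
  proof (induction w)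
    case (Cons x w)
    then show ?case
      using start(2)[of x w] by (cases "x \<in> E") (auto simp: until_lang_simps)
  qed (simp add: until_lang_simps start)
  then have "{w \<in> lists X. from_mark E w \<in> T} = until_lang UNIV ?N T" by blast
  then show ?thesis using ltl_until_UNIV[OF ltl_unmarked T(1)] by simp
qed

lemma ltl_lists_unmarked: "lists (X - E) \<in> ltl_langs R S X"
proof -
  let ?T = "set_Cons (E \<inter> X) (lists X)"
  have "w \<in> lists (X - E) \<longleftrightarrow> w \<in> lists X - {w \<in> lists X. from_mark E w \<in> ?T}" for w
    by (induction w) (auto simp: Cons_mem_set_Cons Nil_notin_set_Cons)
  then have "lists (X - E) = lists X - {w \<in> lists X. from_mark E w \<in> ?T}" by blast
  then show ?thesis
    using ltl_compl[OF ltl_from_mark[OF ltl_marked[OF ltl_lists] order_refl]] by simp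
qed

lemma ltl_langs_Diff_subset: "ltl_langs R S (X - E) \<subseteq> ltl_langs R S X"
proof
  fix P assume "P \<in> ltl_langs R S (X - E)"
  then show "P \<in> ltl_langs R S X"
  proof (induction rule: ltl_langs.induct)
    case (ltl_compl P)
    then show ?case by (intro ltl_Diff ltl_lists_unmarked)
  next
    case (ltl_Cons F P)
    have "set_Cons (F \<inter> (X - E)) P = set_Cons (F \<inter> X) P - set_Cons (E \<inter> X) P"
      by (auto simp: set_Cons_def)
    then show ?case
      by (simp only: ltl_Diff ltl_langs.ltl_Cons ltl_Cons.hyps(1) ltl_Cons.IH ltl_marked)
  qed (auto intro: ltl_langs.intros)
qed

lemma ltl_split_at_mark:
  assumes V: "V \<in> ltl_langs R S (X - E)"
    and T: "T \<in> ltl_langs R S X" "T \<subseteq> set_Cons (E \<inter> X) (lists X)"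
  shows "{w \<in> lists X. before_mark E w \<in> V \<and> from_mark E w \<in> T} \<in> ltl_langs R S X"
    (is "?m V \<in> _")
  using V
proof (induction rule: ltl_langs.induct)
  case ltl_empty
  then show ?case by (simp add: ltl_langs.ltl_empty)
next
  case (ltl_Un P Q)
  have "?m (P \<union> Q) = ?m P \<union> ?m Q" by blast
  then show ?case using ltl_langs.ltl_Un[OF ltl_Un.IH] by simp
next
  case (ltl_compl P)
  have "?m (lists (X - E) - P) = {w \<in> lists X. from_mark E w \<in> T} - ?m P"
    using before_mark_lists[of _ X E] by blast
  then show ?case using ltl_Diff[OF ltl_from_mark[OF T] ltl_compl.IH] by simp
next
  case (ltl_Cons F P)
  have "w \<in> ?m (set_Cons (F \<inter> (X - E)) P) \<longleftrightarrow>
      w \<in> set_Cons (F \<inter> X) (?m P) - set_Cons (E \<inter> X) (lists X)" for w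
    by (cases w) (auto simp: Cons_mem_set_Cons Nil_notin_set_Cons)
  then have "?m (set_Cons (F \<inter> (X - E)) P) = set_Cons (F \<inter> X) (?m P) - set_Cons (E \<inter> X) (lists X)"
    by blast
  then show ?case
    using ltl_Diff[OF ltl_langs.ltl_Cons[OF ltl_Cons.hyps(1) ltl_Cons.IH] ltl_marked[OF ltl_lists]]
    by simp
next
  case (ltl_until L P Q)
  have "?m (until_lang (concat -` L) P Q) =
      until_lang (concat -` L) (?m P - set_Cons (E \<inter> X) (lists X)) (?m Q)"
    using split_at_mark_until_lang_iff[OF T(2), of _ "concat -` L" P Q] by blast
  then show ?case
    using ltl_langs.ltl_until[OF ltl_until.hyps(1)
        ltl_Diff[OF ltl_until.IH(1) ltl_marked[OF ltl_lists]] ltl_until.IH(2)] by simp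
qed

lemma ltl_unmarked_suffix:
  assumes V: "V \<in> ltl_langs R S (X - E)"
  shows "{w \<in> lists X. unmarked_suffix E w \<in> V} \<in> ltl_langs R S X"
proof -
  let ?U = "until_lang UNIV (lists X) (set_Cons (E \<inter> X) V)"
  have marked: "set w \<inter> E \<noteq> {}" if "w \<in> ?U" for w
    using that by (induction w) (auto simp: until_lang_simps)
  have "V \<subseteq> lists (X - E)" by (rule ltl_subset_lists[OF V])
  then have "w \<in> lists X \<and> unmarked_suffix E w \<in> V \<longleftrightarrow> w \<in> V \<union> ?U" for w
  proof (induction w)
    case (Cons x w)
    then show ?case using marked[of w] by (auto simp: until_lang_simps)
  qed (auto simp: until_lang_simps)
  then have "{w \<in> lists X. unmarked_suffix E w \<in> V} = V \<union> ?U" by blast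
  moreover have "V \<union> ?U \<in> ltl_langs R S X"
    using V ltl_langs_Diff_subset by (intro ltl_Un ltl_until_UNIV ltl_lists ltl_marked) auto
  ultimately show ?thesis by simp
qed

end

subsection \<open>Merging the blocks that end in a mark\<close>

text \<open>The letters after the last mark are dropped.\<close>

primrec blocks :: "'a list set \<Rightarrow> 'a list list \<Rightarrow> 'a list list" where
  "blocks E [] = []"
| "blocks E (x # w) = (if x \<in> E then x # blocks E w
     else case blocks E w of [] \<Rightarrow> [] | y # ys \<Rightarrow> (x @ y) # ys)"

lemma blocks_eq_Nil_iff: "blocks E w = [] \<longleftrightarrow> set w \<inter> E = {}"
  by (induction w) (auto split: list.split)

lemma concat_blocks: "concat (blocks E w) @ concat (unmarked_suffix E w) = concat w"
proof (induction w)
  case (Cons x w)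
  then show ?case using blocks_eq_Nil_iff[of E w] by (auto split: list.split)
qed simp

lemma blocks_eq:
  "blocks E w = (case from_mark E w of [] \<Rightarrow> []
     | e # r \<Rightarrow> (concat (before_mark E w) @ e) # blocks E r)"
  by (induction w) (auto simp del: dropWhile_eq_Nil_conv split: list.split)

definition block_letters :: "'a list set \<Rightarrow> 'a list set \<Rightarrow> 'a list set" where
  "block_letters E X = {concat v @ e | v e. v \<in> lists (X - E) \<and> e \<in> E \<inter> X}"

lemma blocks_lists:
  assumes "w \<in> lists X"
  shows "blocks E w \<in> lists (block_letters E X)"
  using assms
proof (induction "length w" arbitrary: w rule: less_induct)
  case less
  show ?case
  proof (cases "from_mark E w")
    case Nil
    then show ?thesis unfolding blocks_eq[of E w] by (simp del: dropWhile_eq_Nil_conv)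
  next
    case (Cons e r)
    have er: "e \<in> E \<inter> X" "r \<in> lists X" using from_mark_ConsD[OF Cons less.prems] by blast+
    then have "concat (before_mark E w) @ e \<in> block_letters E X"
      using before_mark_lists[OF less.prems] by (auto simp: block_letters_def)
    moreover have "length r < length w" using length_dropWhile_le[of "\<lambda>x. x \<notin> E" w] Cons by simp
    then have "blocks E r \<in> lists (block_letters E X)" using less.hyps er(2) by blast
    ultimately show ?thesis by (simp add: blocks_eq[of E w] Cons)
  qed
qed

context
  fixes R S S' :: "'a list rel" and X E :: "'a list set" and c :: "'a list"
  assumes R: "finite_congruence R"
    and E: "saturated S E" "\<And>e. e \<in> E \<Longrightarrow> (c, e) \<in> R"
    and first_block: "\<And>F. saturated S' F \<Longrightarrow>
      \<exists>V \<in> ltl_langs R S (X - E). \<forall>v \<in> lists (X - E). \<forall>e \<in> E \<inter> X. concat v @ e \<in> F \<longleftrightarrow> v \<in> V"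
begin

interpretation finite_congruence R by (rule R)

lemma ltl_blocks_Cons:
  assumes F: "saturated S' F" and P: "{w \<in> lists X. blocks E w \<in> P} \<in> ltl_langs R S X"
  shows "{w \<in> lists X. blocks E w \<in> set_Cons (F \<inter> block_letters E X) P} \<in> ltl_langs R S X"
proof -
  let ?P = "{w \<in> lists X. blocks E w \<in> P}"
  obtain V where V: "V \<in> ltl_langs R S (X - E)"
      "\<And>v e. v \<in> lists (X - E) \<Longrightarrow> e \<in> E \<inter> X \<Longrightarrow> concat v @ e \<in> F \<longleftrightarrow> v \<in> V"
    using first_block[OF F] by blast
  have "blocks E w \<in> set_Cons (F \<inter> block_letters E X) P \<longleftrightarrow>
      before_mark E w \<in> V \<and> from_mark E w \<in> set_Cons (E \<inter> X) ?P" if w: "w \<in> lists X" for w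
  proof (cases "from_mark E w")
    case (Cons e r)
    have er: "e \<in> E \<inter> X" "r \<in> lists X" using from_mark_ConsD[OF Cons w] by blast+
    have "concat (before_mark E w) @ e \<in> block_letters E X"
      using er before_mark_lists[OF w] by (auto simp: block_letters_def)
    then show ?thesis
      using er V(2)[OF before_mark_lists[OF w] er(1)]
      by (auto simp: blocks_eq[of E w] Cons Cons_mem_set_Cons)
  qed (simp add: blocks_eq[of E w] Nil_notin_set_Cons del: dropWhile_eq_Nil_conv)
  then have "{w \<in> lists X. blocks E w \<in> set_Cons (F \<inter> block_letters E X) P} =
      {w \<in> lists X. before_mark E w \<in> V \<and> from_mark E w \<in> set_Cons (E \<inter> X) ?P}" by blast
  also have "\<dots> \<in> ltl_langs R S X"
    by (intro ltl_split_at_mark E(1) V(1) ltl_marked P) (auto simp: set_Cons_def)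
  finally show ?thesis .
qed

lemma blocks_Cons_until_lang_iff:
  fixes P T :: "'a list list set"
  defines "P' \<equiv> {w \<in> lists X. blocks E w \<in> P}" and "T' \<equiv> {w \<in> lists X. blocks E w \<in> T}"
  defines "N \<equiv> (lists X - set_Cons (E \<inter> X) (lists X)) \<union> set_Cons (E \<inter> X) P'"
  assumes "w \<in> lists X" "saturated R K"
  shows "w \<in> until_lang (concat -` rquot K c) N (set_Cons (E \<inter> X) T') \<longleftrightarrow>
    (\<exists>y ys. blocks E w = y # ys \<and> ys \<in> until_lang (concat -` lquot y K) P T)"
  using assms(4,5)
proof (induction w arbitrary: K rule: list.induct)
  case (Cons x w)
  let ?U = "\<lambda>K. until_lang (concat -` rquot K c) N (set_Cons (E \<inter> X) T')"
  have IH: "w \<in> ?U (lquot x K) \<longleftrightarrow>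
      (\<exists>y ys. blocks E w = y # ys \<and> ys \<in> until_lang (concat -` lquot (x @ y) K) P T)"
    using Cons.IH[of "lquot x K"] Cons.prems saturated_lquot by (simp add: lquot_append)
  have "lquot x (rquot K c) = rquot (lquot x K) c" by auto
  then have U_Cons: "x # w \<in> ?U K \<longleftrightarrow>
      c \<in> K \<and> x # w \<in> set_Cons (E \<inter> X) T' \<or> x # w \<in> N \<and> w \<in> ?U (lquot x K)"
    by (simp add: until_lang_simps)
  show ?case
  proof (cases "x \<in> E")
    case True
    then have "c \<in> K \<longleftrightarrow> x \<in> K"
      using saturated_iff[OF equiv Cons.prems(2) E(2)] by blast
    then have "x # w \<in> ?U K \<longleftrightarrow> x \<in> K \<and> blocks E w \<in> T \<or> blocks E w \<in> P \<and> w \<in> ?U (lquot x K)"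
      unfolding U_Cons using True Cons.prems(1)
      by (auto simp: Cons_mem_set_Cons N_def P'_def T'_def)
    also have "\<dots> \<longleftrightarrow> blocks E w \<in> until_lang (concat -` lquot x K) P T"
      unfolding IH by (cases "blocks E w") (auto simp: until_lang_simps lquot_append)
    finally show ?thesis using True by simp
  next
    case False
    then have "x # w \<in> ?U K \<longleftrightarrow> w \<in> ?U (lquot x K)"
      unfolding U_Cons using Cons.prems(1) by (auto simp: Cons_mem_set_Cons N_def)
    then show ?thesis unfolding IH using False by (auto split: list.split)
  qed
qed (simp add: until_lang_simps)

lemma ltl_blocks_until:
  assumes L: "saturated R L"
    and P: "{w \<in> lists X. blocks E w \<in> P} \<in> ltl_langs R S X" (is "?P \<in> _")
    and T: "{w \<in> lists X. blocks E w \<in> T} \<in> ltl_langs R S X" (is "?T \<in> _")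
  shows "{w \<in> lists X. blocks E w \<in> until_lang (concat -` L) P T} \<in> ltl_langs R S X"
proof -
  let ?N = "(lists X - set_Cons (E \<inter> X) (lists X)) \<union> set_Cons (E \<inter> X) ?P"
  let ?U = "until_lang (concat -` rquot L c) ?N (set_Cons (E \<inter> X) ?T)"
  have "blocks E w \<in> until_lang (concat -` L) P T \<longleftrightarrow>
      [] \<in> L \<and> blocks E w \<in> T \<or> blocks E w \<in> P \<and> w \<in> ?U" if "w \<in> lists X" for w
    unfolding blocks_Cons_until_lang_iff[OF that L]
    by (cases "blocks E w") (auto simp: until_lang_simps)
  then have "{w \<in> lists X. blocks E w \<in> until_lang (concat -` L) P T} =
      (if [] \<in> L then ?T else {}) \<union> (?P \<inter> ?U)" by auto
  also have "\<dots> \<in> ltl_langs R S X"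
    using T by (intro ltl_Un ltl_Int ltl_until saturated_rquot L ltl_unmarked ltl_marked E(1) P)
      (auto intro: ltl_empty)
  finally show ?thesis .
qed

lemma ltl_blocks:
  assumes "K \<in> ltl_langs R S' (block_letters E X)"
  shows "{w \<in> lists X. blocks E w \<in> K} \<in> ltl_langs R S X"
  using assms
proof (induction rule: ltl_langs.induct)
  case ltl_empty
  then show ?case by (simp add: ltl_langs.ltl_empty)
next
  case (ltl_Un P T)
  have "{w \<in> lists X. blocks E w \<in> P \<union> T} =
      {w \<in> lists X. blocks E w \<in> P} \<union> {w \<in> lists X. blocks E w \<in> T}" by blast
  then show ?case using ltl_langs.ltl_Un[OF ltl_Un.IH] by simp
next
  case (ltl_compl P)
  have "{w \<in> lists X. blocks E w \<in> lists (block_letters E X) - P} =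
      lists X - {w \<in> lists X. blocks E w \<in> P}" using blocks_lists by blast
  then show ?case using ltl_langs.ltl_compl[OF ltl_compl.IH] by simp
next
  case (ltl_Cons F P)
  then show ?case by (intro ltl_blocks_Cons)
next
  case (ltl_until L P T)
  then show ?case by (intro ltl_blocks_until)
qed

end

section \<open>Pumping modulo a congruence\<close>

abbreviation word_pow :: "'a list \<Rightarrow> nat \<Rightarrow> 'a list" where
  "word_pow x n \<equiv> concat (replicate n x)"

lemma word_pow_add: "word_pow x (m + n) = word_pow x m @ word_pow x n"
  by (simp add: replicate_add)

definition pumps :: "'a list rel \<Rightarrow> nat \<Rightarrow> 'a list set \<Rightarrow> bool" where
  "pumps R n L \<longleftrightarrow> (\<forall>x u v. (x, x @ x) \<in> R \<longrightarrow>
    (u @ word_pow x n @ v \<in> L \<longleftrightarrow> u @ word_pow x (Suc n) @ v \<in> L))"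

lemma pumpsD:
  "pumps R n L \<Longrightarrow> (x, x @ x) \<in> R \<Longrightarrow> u @ word_pow x n @ v \<in> L \<longleftrightarrow> u @ word_pow x (Suc n) @ v \<in> L"
  unfolding pumps_def by blast

lemma pumps_lquot:
  assumes "pumps R n L"
  shows "pumps R n (lquot u L)"
  unfolding pumps_def
proof (intro allI impI)
  fix x v w assume "(x, x @ x) \<in> R"
  from pumpsD[OF assms this, of "u @ v" w]
  show "v @ word_pow x n @ w \<in> lquot u L \<longleftrightarrow> v @ word_pow x (Suc n) @ w \<in> lquot u L"
    by (simp del: replicate.simps)
qed

lemma pumps_lquot_eq:
  assumes "pumps R n L" "(x, x @ x) \<in> R"
  shows "lquot (word_pow x n) L = lquot (word_pow x (Suc n)) L"
  using pumpsD[OF assms, of "[]"] by (simp add: set_eq_iff del: replicate.simps)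

lemma pumps_mono:
  assumes "pumps R n L" "n \<le> m" "S \<subseteq> R"
  shows "pumps S m L"
  unfolding pumps_def
proof (intro allI impI)
  fix x u v assume "(x, x @ x) \<in> S"
  then have x: "(x, x @ x) \<in> R" using assms(3) by blast
  obtain k where k: "m = n + k" using assms(2) le_Suc_ex by blast
  have "u @ word_pow x m @ v \<in> L \<longleftrightarrow> u @ word_pow x n @ (word_pow x k @ v) \<in> L"
    unfolding k word_pow_add by simp
  also have "\<dots> \<longleftrightarrow> u @ word_pow x (Suc n) @ (word_pow x k @ v) \<in> L"
    by (rule pumpsD[OF assms(1) x])
  also have "\<dots> \<longleftrightarrow> u @ word_pow x (Suc m) @ v \<in> L"
    unfolding k add_Suc[symmetric] word_pow_add by simp
  finally show "u @ word_pow x m @ v \<in> L \<longleftrightarrow> u @ word_pow x (Suc m) @ v \<in> L" .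
qed

lemma pumps_Un: "pumps R n L \<Longrightarrow> pumps R n K \<Longrightarrow> pumps R n (L \<union> K)"
  unfolding pumps_def by blast

lemma pumps_Compl: "pumps R n L \<Longrightarrow> pumps R n (- L)"
  unfolding pumps_def by blast

lemma word_pow_in_conc_transfer:
  assumes L: "\<And>u v. u @ word_pow x k @ v \<in> L \<Longrightarrow> u @ word_pow x k' @ v \<in> L"
    and K: "\<And>u v. u @ word_pow x m @ v \<in> K \<Longrightarrow> u @ word_pow x m' @ v \<in> K"
    and eq: "k' + m = N" "k + m' = N"
    and w: "u @ word_pow x (k + m) @ v \<in> conc L K"
  shows "u @ word_pow x N @ v \<in> conc L K"
proof -
  obtain p q where pq: "(u @ word_pow x k) @ (word_pow x m @ v) = p @ q" "p \<in> L" "q \<in> K"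
    using w unfolding word_pow_add conc_def by auto
  from pq(1) consider
    (within_first) t where "p = (u @ word_pow x k) @ t" "word_pow x m @ v = t @ q"
    | (within_second) t where "u @ word_pow x k = p @ t" "q = t @ word_pow x m @ v"
    unfolding append_eq_append_conv2[of "u @ word_pow x k"] by blast
  then show ?thesis
  proof cases
    case within_first
    then have "u @ word_pow x k' @ t \<in> L" using L[of u t] pq(2) by simp
    then have "(u @ word_pow x k' @ t) @ q \<in> conc L K"
      using pq(3) unfolding conc_def by blast
    also have "(u @ word_pow x k' @ t) @ q = u @ word_pow x N @ v"
      unfolding eq(1)[symmetric] word_pow_add using within_first(2) by simp
    finally show ?thesis .
  next
    case within_second
    then have "p @ (t @ word_pow x m' @ v) \<in> conc L K"
      using K[of t v] pq(2,3) unfolding conc_def by blast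
    also have "p @ t @ word_pow x m' @ v = u @ word_pow x N @ v"
      unfolding eq(2)[symmetric] word_pow_add append_assoc[symmetric] within_second(1)[symmetric]
      by simp
    finally show ?thesis .
  qed
qed

lemma pumps_conc:
  assumes L: "pumps R n L" and K: "pumps R n K"
  shows "pumps R (Suc (n + n)) (conc L K)"
  unfolding pumps_def
proof (intro allI impI iffI)
  fix x u v assume x: "(x, x @ x) \<in> R"
  have K': "pumps R (Suc n) K" by (rule pumps_mono[OF K]) auto
  {
    assume "u @ word_pow x (Suc (n + n)) @ v \<in> conc L K"
    then have "u @ word_pow x (n + Suc n) @ v \<in> conc L K" by simp
    then show "u @ word_pow x (Suc (Suc (n + n))) @ v \<in> conc L K"
      by (rule word_pow_in_conc_transfer[rotated -1, where k' = "Suc n" and m' = "Suc (Suc n)"])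
        (use pumpsD[OF L x] pumpsD[OF K' x] in simp_all)
  next
    assume "u @ word_pow x (Suc (Suc (n + n))) @ v \<in> conc L K"
    then have "u @ word_pow x (Suc n + Suc n) @ v \<in> conc L K" by simp
    then show "u @ word_pow x (Suc (n + n)) @ v \<in> conc L K"
      by (rule word_pow_in_conc_transfer[rotated -1, where k' = n and m' = n])
        (use pumpsD[OF L x] pumpsD[OF K x] in simp_all)
  }
qed

lemma (in finite_congruence) pumps_saturated:
  assumes "saturated R L"
  shows "pumps R 1 L"
  unfolding pumps_def
proof (intro allI impI)
  fix x u v assume "(x, x @ x) \<in> R"
  then have "(u @ word_pow x 1 @ v, u @ word_pow x (Suc 1) @ v) \<in> R"
    by (intro append_cong cong_refl) simp
  then show "u @ word_pow x 1 @ v \<in> L \<longleftrightarrow> u @ word_pow x (Suc 1) @ v \<in> L"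
    by (rule saturated_iff[OF equiv assms])
qed

lemma pumps_letter: "pumps R 2 {[a]}"
  unfolding pumps_def
proof (intro allI impI)
  fix x u v
  show "u @ word_pow x 2 @ v \<in> {[a]} \<longleftrightarrow> u @ word_pow x (Suc 2) @ v \<in> {[a]}"
    by (cases x) (auto simp: numeral_2_eq_2 Cons_eq_append_conv append_eq_Cons_conv)
qed

lemma (in quotient_algebra) ex_common_pumping:
  assumes "congruence_over R" "pumps R n L" "congruence_over S" "pumps S m K"
  shows "\<exists>T k. congruence_over T \<and> pumps T k L \<and> pumps T k K"
proof -
  obtain T where "congruence_over T" "T \<subseteq> R" "T \<subseteq> S"
    using ex_common_refinement[OF assms(1,3)] by blast
  moreover from this have "pumps T (n + m) L" "pumps T (n + m) K"
    using pumps_mono[OF assms(2)] pumps_mono[OF assms(4)] by simp_all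
  ultimately show ?thesis by blast
qed

lemma SF_pumps:
  assumes "quotient_algebra C" and "L \<in> SF C"
  shows "\<exists>R n. quotient_algebra.congruence_over C R \<and> pumps R n L"
proof -
  interpret quotient_algebra C by (rule assms(1))
  show ?thesis
    using assms(2)
  proof (induction rule: SF.induct)
    case (SF_base L)
    then obtain R where R: "congruence_over R" "saturated R L"
      using ex_saturating_congruence[of "{L}"] by auto
    then show ?case
      using finite_congruence.pumps_saturated[OF congruence_over_finite_congruence[OF R(1)] R(2)]
      by blast
  next
    case (SF_letter a)
    obtain R where "congruence_over R" using ex_saturating_congruence[of "{}"] by auto
    then show ?case using pumps_letter[of R a] by blast
  next
    case (SF_compl L)
    then show ?case using pumps_Compl by blast
  next
    case (SF_union L K)
    then show ?case using ex_common_pumping[of _ _ L _ _ K] pumps_Un by metis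
  next
    case (SF_conc L K)
    then show ?case using ex_common_pumping[of _ _ L _ _ K] pumps_conc by metis
  qed
qed

section \<open>Defining the action of words on states\<close>

lemma bij_betw_lquot_concat:
  assumes "\<And>x. x \<in> set w \<Longrightarrow> bij_betw (lquot x) Q Q"
  shows "bij_betw (lquot (concat w)) Q Q"
  using assms
proof (induction w)
  case Nil
  show ?case by (simp add: bij_betw_def)
next
  case (Cons x w)
  have "bij_betw (lquot (concat w) \<circ> lquot x) Q Q"
    by (rule bij_betw_trans) (use Cons in simp_all)
  moreover have "lquot (concat w) \<circ> lquot x = lquot (concat (x # w))"
    by (simp add: fun_eq_iff lquot_append)
  ultimately show ?case by simp
qed

lemma bij_betw_idempotent_trivial:
  assumes "pumps R n q" "(z, z @ z) \<in> R" and bij: "bij_betw (lquot z) Q Q" and q: "q \<in> Q"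
  shows "lquot z q = q"
proof -
  have "bij_betw (lquot (word_pow z n)) Q Q"
    by (rule bij_betw_lquot_concat) (use bij in simp)
  moreover have "lquot (word_pow z n) (lquot z q) = lquot (word_pow z n) q"
    using pumps_lquot_eq[OF assms(1,2)] by (simp add: lquot_append)
  moreover have "lquot z q \<in> Q" using bij q by (rule bij_betwE[rule_format])
  ultimately show ?thesis using q by (auto simp: bij_betw_def dest: inj_onD)
qed

definition runs :: "'a list set \<Rightarrow> 'a list set \<Rightarrow> 'a list set \<Rightarrow> 'a list list set" where
  "runs X p q = {w \<in> lists X. lquot (concat w) p = q}"

definition stable :: "'a list set \<Rightarrow> 'a list set set \<Rightarrow> bool" where
  "stable X Q \<longleftrightarrow> (\<forall>x\<in>X. \<forall>q\<in>Q. lquot x q \<in> Q)"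

lemma stable_concat: "stable X Q \<Longrightarrow> w \<in> lists X \<Longrightarrow> q \<in> Q \<Longrightarrow> lquot (concat w) q \<in> Q"
  by (induction w arbitrary: q) (auto simp: stable_def lquot_append)

context finite_congruence
begin

lemma ex_idempotent_power: "\<exists>k. (word_pow x (Suc k), word_pow x (Suc k) @ word_pow x (Suc k)) \<in> R"
proof -
  have "finite (range (\<lambda>i. R `` {word_pow x (2 ^ i)}))"
    by (rule finite_subset[OF _ finite_quotient]) (auto intro: quotientI)
  then have "\<not> inj (\<lambda>i. R `` {word_pow x (2 ^ i)})"
    using finite_imageD[of _ "UNIV :: nat set"] infinite_UNIV_nat by blast
  then obtain i j where "i < j" "R `` {word_pow x (2 ^ i)} = R `` {word_pow x (2 ^ j)}"
    using linorder_injI[of "\<lambda>i. R `` {word_pow x (2 ^ i)}"] by blast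
  then have ij: "(word_pow x (2 ^ j), word_pow x (2 ^ i)) \<in> R"
    using eq_equiv_class[OF _ equiv] by blast
  define n :: nat where "n = 2 ^ j - 2 ^ i"
  have "2 * 2 ^ i \<le> (2 :: nat) ^ j"
    using \<open>i < j\<close> power_increasing[of "Suc i" j "2 :: nat"] by simp
  then have n: "n + n = 2 ^ j + (n - 2 ^ i)" "n = 2 ^ i + (n - 2 ^ i)" "n > 0"
    unfolding n_def using zero_less_power[of "2 :: nat" i] by linarith+
  have "(word_pow x (2 ^ j) @ word_pow x (n - 2 ^ i),
      word_pow x (2 ^ i) @ word_pow x (n - 2 ^ i)) \<in> R"
    by (rule append_cong[OF ij cong_refl])
  then have "(word_pow x (n + n), word_pow x n) \<in> R"
    unfolding word_pow_add[symmetric] n(1)[symmetric] n(2)[symmetric] .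
  then have "(word_pow x n, word_pow x n @ word_pow x n) \<in> R"
    unfolding word_pow_add by (rule cong_sym)
  then show ?thesis using n(3) gr0_conv_Suc by auto
qed

text \<open>If \<open>x\<close> and \<open>y\<close> are congruent and \<open>y\<^sup>k\<^sup>+\<^sup>1\<close> is idempotent modulo the congruence, then so is
  \<open>x y\<^sup>k\<close>; when \<open>x\<close> and \<open>y\<close> permute \<open>Q\<close>, both words act trivially by pumping.\<close>

lemma congruent_permutations_eq:
  assumes Q: "\<And>q. q \<in> Q \<Longrightarrow> pumps R n q"
    and x: "bij_betw (lquot x) Q Q" and y: "bij_betw (lquot y) Q Q"
    and xy: "(x, y) \<in> R" and q: "q \<in> Q"
  shows "lquot x q = lquot y q"
proof -
  obtain k where k: "(word_pow y (Suc k), word_pow y (Suc k) @ word_pow y (Suc k)) \<in> R"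
    using ex_idempotent_power by blast
  let ?z = "x @ word_pow y k"
  have z: "(?z, word_pow y (Suc k)) \<in> R" using append_cong[OF xy cong_refl] by simp
  then have "(?z, ?z @ ?z) \<in> R"
    using cong_trans[OF cong_trans[OF z k]] append_cong cong_sym by blast
  have bij: "bij_betw (lquot (concat ws)) Q Q" if "set ws \<subseteq> {x, y}" for ws
    using that x y by (intro bij_betw_lquot_concat) auto
  have yk: "bij_betw (lquot (word_pow y k)) Q Q" by (rule bij) (simp add: set_replicate_conv_if)
  have "lquot ?z q = q"
    using bij_betw_idempotent_trivial[OF Q[OF q] \<open>(?z, ?z @ ?z) \<in> R\<close> _ q]
      bij[of "x # replicate k y"]
    by (simp add: set_replicate_conv_if)
  moreover have "lquot (y @ word_pow y k) q = q"
    using bij_betw_idempotent_trivial[OF Q[OF q] k _ q] bij[of "replicate (Suc k) y"]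
    by (simp add: set_replicate_conv_if)
  ultimately have "lquot (word_pow y k) (lquot x q) = lquot (word_pow y k) (lquot y q)"
    by (simp add: lquot_append)
  then show ?thesis
    using yk bij_betwE[OF x] bij_betwE[OF y] q by (auto simp: bij_betw_def dest: inj_onD)
qed

lemma runs_permutations:
  assumes Q: "\<And>q. q \<in> Q \<Longrightarrow> pumps R n q" and X: "\<And>x. x \<in> X \<Longrightarrow> bij_betw (lquot x) Q Q" and p: "p \<in> Q"
  shows "runs X p q \<in> ltl_langs R S X"
proof -
  let ?L = "R `` concat ` runs X p q"
  have "w \<in> runs X p q \<longleftrightarrow> concat w \<in> ?L" if w: "w \<in> lists X" for w
  proof
    assume "concat w \<in> ?L"
    then obtain w' where w': "w' \<in> runs X p q" "(concat w', concat w) \<in> R" by blast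
    have "bij_betw (lquot (concat v)) Q Q" if "v \<in> lists X" for v
      by (rule bij_betw_lquot_concat) (use that X in auto)
    then have "lquot (concat w') p = lquot (concat w) p"
      using congruent_permutations_eq[OF Q _ _ w'(2) p] w w'(1) by (simp add: runs_def)
    then show "w \<in> runs X p q" using w w'(1) by (simp add: runs_def)
  qed (auto intro: cong_refl)
  then have runs: "runs X p q = {w \<in> lists X. concat w \<in> ?L}" by (auto simp: runs_def)
  have "saturated R ?L"
    using cong_trans unfolding saturated_def by blast
  then show ?thesis by (subst runs) (rule ltl_concat)
qed

definition alike :: "'a list set set \<Rightarrow> 'a list rel" where
  "alike Q = R \<inter> same_action Q"

lemma equiv_alike: "equiv UNIV (alike Q)"
  unfolding alike_def by (intro equiv_Int equiv equiv_same_action)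

lemma finite_quotient_alike:
  "finite Q \<Longrightarrow> (\<And>q. q \<in> Q \<Longrightarrow> finite_index q) \<Longrightarrow> finite (UNIV // alike Q)"
  unfolding alike_def by (intro finite_quotient_Int finite_quotient finite_quotient_same_action)

end

text \<open>A letter \<open>c\<close> that does not permute \<open>Q\<close> sends it to a smaller set of states. Words are cut
  after each letter acting like \<open>c\<close>, and the blocks become the letters of an alphabet acting on
  that set.\<close>

locale marked_alphabet = finite_congruence R for R :: "'a list rel" +
  fixes X :: "'a list set" and Q :: "'a list set set" and c :: "'a list"
  assumes finite_states: "finite Q" "\<And>q. q \<in> Q \<Longrightarrow> finite_index q"
    and stable: "stable X Q" and c_letter: "c \<in> X"
begin

definition marks :: "'a list set" where
  "marks = alike Q `` {c}"

lemma saturated_marks: "saturated (alike Q) marks"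
  unfolding marks_def by (rule saturated_class[OF equiv_alike])

lemma marks_cong: "e \<in> marks \<Longrightarrow> (c, e) \<in> R"
  by (simp add: marks_def alike_def)

lemma lquot_mark: "e \<in> marks \<Longrightarrow> q \<in> Q \<Longrightarrow> lquot e q = lquot c q"
  by (simp add: marks_def alike_def same_action_def)

lemma mark_image_subset: "lquot c ` Q \<subseteq> Q"
  using stable c_letter by (auto simp: stable_def)

lemma stable_unmarked: "stable (X - marks) Q"
  using stable by (simp add: stable_def)

lemma stable_block_letters: "stable (block_letters marks X) (lquot c ` Q)"
  unfolding stable_def
proof (intro ballI)
  fix y q assume "y \<in> block_letters marks X" "q \<in> lquot c ` Q"
  then obtain v e where ve: "y = concat v @ e" "v \<in> lists (X - marks)" "e \<in> marks" and q: "q \<in> Q"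
    using mark_image_subset unfolding block_letters_def by blast
  have "lquot (concat v) q \<in> Q" by (rule stable_concat[OF stable_unmarked ve(2) q])
  then show "lquot y q \<in> lquot c ` Q" using lquot_mark ve by (simp add: lquot_append)
qed

lemma card_unmarked_letters: "card ((X - marks) // alike Q) < card (X // alike Q)"
proof (rule psubset_card_mono)
  show "finite (X // alike Q)"
    by (rule finite_subset[OF quotient_mono finite_quotient_alike]) (simp_all add: finite_states)
  have "marks \<in> X // alike Q" "marks \<notin> (X - marks) // alike Q"
    using c_letter equiv_class_self[OF equiv_alike, of c] eq_equiv_class[OF _ equiv_alike]
    by (auto simp: marks_def quotient_def)
  then show "(X - marks) // alike Q \<subset> X // alike Q"
    using quotient_mono[of "X - marks" X "alike Q"] by blast
qed

lemma mem_runs_iff_split_at_mark: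
  assumes p: "p \<in> Q" and w: "w \<in> lists X"
  shows "w \<in> runs X p q \<longleftrightarrow> w \<in> runs (X - marks) p q \<or>
    (\<exists>s\<in>Q. before_mark marks w \<in> runs (X - marks) p s \<and>
      from_mark marks w \<in> set_Cons (marks \<inter> X) (runs X (lquot c s) q))"
proof (cases "from_mark marks w")
  case Nil
  then have "w \<in> lists (X - marks)" using w by (auto simp: dropWhile_eq_Nil_conv)
  then show ?thesis using w unfolding Nil by (simp add: runs_def Nil_notin_set_Cons)
next
  case (Cons e r)
  let ?v = "before_mark marks w"
  have er: "e \<in> marks" "e \<in> X" "r \<in> lists X" using from_mark_ConsD[OF Cons w] by blast+
  have w_eq: "w = ?v @ e # r" using takeWhile_dropWhile_id[of _ w] Cons by metis
  have "w \<notin> lists (X - marks)" using er(1) by (subst w_eq) simp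
  moreover have v: "?v \<in> lists (X - marks)" by (rule before_mark_lists[OF w])
  moreover have "lquot (concat ?v) p \<in> Q" by (rule stable_concat[OF stable_unmarked v p])
  moreover from this have "lquot (concat w) p = lquot (concat r) (lquot c (lquot (concat ?v) p))"
    using lquot_mark[OF er(1)] by (subst w_eq) (simp add: lquot_append)
  ultimately show ?thesis
    using w er unfolding Cons by (auto simp: runs_def Cons_mem_set_Cons)
qed

context
  assumes unmarked_runs: "\<And>p q. p \<in> Q \<Longrightarrow> runs (X - marks) p q \<in> ltl_langs R (alike Q) (X - marks)"
begin

lemma ltl_concat_saturated:
  assumes "saturated (alike Q) W"
  shows "{v \<in> lists (X - marks). concat v \<in> W} \<in> ltl_langs R (alike Q) (X - marks)"
proof -
  let ?B = "lists (X - marks)"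
  have class_definable: "{v \<in> ?B. concat v \<in> alike Q `` {u}} \<in> ltl_langs R (alike Q) (X - marks)"
    for u
  proof -
    have "{v \<in> ?B. lquot (concat v) q = lquot u q} \<in> ltl_langs R (alike Q) (X - marks)"
      if "q \<in> Q" for q
      using unmarked_runs[OF that] by (simp add: runs_def)
    then have "{v \<in> ?B. concat v \<in> R `` {u}} \<inter> {v \<in> ?B. \<forall>q\<in>Q. lquot (concat v) q = lquot u q}
        \<in> ltl_langs R (alike Q) (X - marks)"
      by (intro ltl_Int ltl_concat saturated_class equiv ltl_Ball finite_states(1))
    also have "{v \<in> ?B. concat v \<in> R `` {u}} \<inter> {v \<in> ?B. \<forall>q\<in>Q. lquot (concat v) q = lquot u q} =
        {v \<in> ?B. concat v \<in> alike Q `` {u}}"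
      by (auto simp: alike_def same_action_def)
    finally show ?thesis .
  qed
  have "(\<Union>U\<in>W // alike Q. {v \<in> ?B. concat v \<in> U}) \<in> ltl_langs R (alike Q) (X - marks)"
  proof (rule ltl_UN)
    show "finite (W // alike Q)"
      by (rule finite_subset[OF quotient_mono finite_quotient_alike]) (simp_all add: finite_states)
  qed (auto elim!: quotientE intro: class_definable)
  also have "(\<Union>U\<in>W // alike Q. {v \<in> ?B. concat v \<in> U}) = {v \<in> ?B. concat v \<in> \<Union> (W // alike Q)}"
    by blast
  also have "\<dots> = {v \<in> ?B. concat v \<in> W}"
    by (simp only: Union_quotient_saturated[OF equiv_alike assms])
  finally show ?thesis .
qed

lemma ltl_first_block:
  assumes F: "saturated (alike (lquot c ` Q)) F"
  shows "\<exists>V \<in> ltl_langs R (alike Q) (X - marks). \<forall>v \<in> lists (X - marks). \<forall>e \<in> marks \<inter> X.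
    concat v @ e \<in> F \<longleftrightarrow> v \<in> V"
proof (intro bexI ballI)
  show "{v \<in> lists (X - marks). concat v \<in> rquot F c} \<in> ltl_langs R (alike Q) (X - marks)"
  proof (rule ltl_concat_saturated)
    show "saturated (alike Q) (rquot F c)"
      unfolding saturated_def
    proof clarify
      fix u v assume "u \<in> rquot F c" "(u, v) \<in> alike Q"
      moreover from this have "(u @ c, v @ c) \<in> alike (lquot c ` Q)"
        using mark_image_subset append_cong[OF _ cong_refl]
        by (auto simp: alike_def same_action_def lquot_append)
      ultimately show "v \<in> rquot F c" using saturatedD[OF F] by auto
    qed
  qed
  fix v e assume v: "v \<in> lists (X - marks)" and e: "e \<in> marks \<inter> X"
  have "lquot (concat v @ c) q = lquot (concat v @ e) q" if "q \<in> lquot c ` Q" for q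
    using stable_concat[OF stable_unmarked v] lquot_mark mark_image_subset e that
    by (auto simp: lquot_append)
  moreover have "(concat v @ c, concat v @ e) \<in> R"
    using append_cong[OF cong_refl] marks_cong e by blast
  ultimately have "(concat v @ c, concat v @ e) \<in> alike (lquot c ` Q)"
    by (simp add: alike_def same_action_def)
  then show "concat v @ e \<in> F \<longleftrightarrow> v \<in> {v \<in> lists (X - marks). concat v \<in> rquot F c}"
    using saturated_iff[OF equiv_alike F] v by auto
qed

context
  assumes block_runs: "\<And>p q. p \<in> lquot c ` Q \<Longrightarrow>
    runs (block_letters marks X) p q \<in> ltl_langs R (alike (lquot c ` Q)) (block_letters marks X)"
begin

lemma runs_from_mark_image:
  assumes p: "p \<in> lquot c ` Q"
  shows "runs X p q \<in> ltl_langs R (alike Q) X"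
proof -
  let ?Y = "block_letters marks X"
  let ?A = "\<lambda>s. {w \<in> lists X. blocks marks w \<in> runs ?Y p s}"
  let ?B = "\<lambda>s. {w \<in> lists X. unmarked_suffix marks w \<in> runs (X - marks) s q}"
  have "w \<in> runs X p q \<longleftrightarrow> w \<in> (\<Union>s\<in>lquot c ` Q. ?A s \<inter> ?B s)" for w
  proof (cases "w \<in> lists X")
    case w: True
    let ?s = "lquot (concat (blocks marks w)) p"
    have "?s \<in> lquot c ` Q"
      by (rule stable_concat[OF stable_block_letters blocks_lists[OF w] p])
    moreover have "w \<in> ?A s \<longleftrightarrow> s = ?s" for s
      using w blocks_lists[OF w] by (auto simp: runs_def)
    ultimately have "w \<in> (\<Union>s\<in>lquot c ` Q. ?A s \<inter> ?B s) \<longleftrightarrow> w \<in> ?B ?s"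
      unfolding UN_iff Int_iff by simp
    also have "\<dots> \<longleftrightarrow> lquot (concat (unmarked_suffix marks w)) ?s = q"
      using w unmarked_suffix_lists[OF w] by (simp add: runs_def)
    also have "\<dots> \<longleftrightarrow> w \<in> runs X p q"
      using w by (simp add: runs_def concat_blocks flip: lquot_append)
    finally show ?thesis by simp
  qed (simp add: runs_def)
  then have "runs X p q = (\<Union>s\<in>lquot c ` Q. ?A s \<inter> ?B s)" by (rule set_eqI)
  also have "\<dots> \<in> ltl_langs R (alike Q) X"
  proof (intro ltl_UN ltl_Int)
    fix s assume "s \<in> lquot c ` Q"
    then have "s \<in> Q" using mark_image_subset by blast
    then show "?B s \<in> ltl_langs R (alike Q) X"
      by (intro ltl_unmarked_suffix saturated_marks unmarked_runs)
    show "?A s \<in> ltl_langs R (alike Q) X"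
      by (rule ltl_blocks[OF finite_congruence_axioms saturated_marks marks_cong ltl_first_block
          block_runs[OF p]])
  qed (simp add: finite_states)
  finally show ?thesis .
qed

lemma runs_marked_alphabet:
  assumes p: "p \<in> Q"
  shows "runs X p q \<in> ltl_langs R (alike Q) X"
proof -
  let ?T = "\<lambda>s. set_Cons (marks \<inter> X) (runs X (lquot c s) q)"
  have "w \<in> runs X p q \<longleftrightarrow> w \<in> runs (X - marks) p q \<or> (\<exists>s\<in>Q. w \<in> lists X \<and>
      before_mark marks w \<in> runs (X - marks) p s \<and> from_mark marks w \<in> ?T s)" for w
    using mem_runs_iff_split_at_mark[OF p, of w q] by (cases "w \<in> lists X") (auto simp: runs_def)
  then have "runs X p q = runs (X - marks) p q \<union>
      (\<Union>s\<in>Q. {w \<in> lists X. before_mark marks w \<in> runs (X - marks) p s \<and> from_mark marks w \<in> ?T s})"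
    by blast
  also have "\<dots> \<in> ltl_langs R (alike Q) X"
  proof (intro ltl_Un ltl_UN finite_states(1))
    show "runs (X - marks) p q \<in> ltl_langs R (alike Q) X"
      using ltl_langs_Diff_subset[OF saturated_marks] unmarked_runs[OF p] by blast
    fix s assume "s \<in> Q"
    then have "runs X (lquot c s) q \<in> ltl_langs R (alike Q) X" by (intro runs_from_mark_image) simp
    then show "{w \<in> lists X. before_mark marks w \<in> runs (X - marks) p s \<and> from_mark marks w \<in> ?T s}
        \<in> ltl_langs R (alike Q) X"
      by (intro ltl_split_at_mark saturated_marks unmarked_runs p ltl_marked)
        (auto simp: set_Cons_def runs_def)
  qed
  finally show ?thesis .
qed

end

end

end

context finite_congruence
begin

lemma runs_definable:
  assumes "finite Q" "\<And>q. q \<in> Q \<Longrightarrow> finite_index q" "\<And>q. q \<in> Q \<Longrightarrow> pumps R n q"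
    and "stable X Q" "p \<in> Q"
  shows "runs X p q \<in> ltl_langs R (alike Q) X"
  using assms
proof (induction "card Q" arbitrary: Q X p q rule: less_induct)
  case (less Q)
  note outer_IH = less.hyps and Q = less.prems(1-3)
  show ?case using less.prems(4,5)
  proof (induction "card (X // alike Q)" arbitrary: X p q rule: less_induct)
    case (less X)
    show ?case
    proof (cases "\<forall>x\<in>X. inj_on (lquot x) Q")
      case True
      then have "bij_betw (lquot x) Q Q" if "x \<in> X" for x
        using that less.prems(1) endo_inj_surj[OF Q(1), of "lquot x"]
        by (auto simp: bij_betw_def stable_def)
      then show ?thesis using Q(3) less.prems(2) by (intro runs_permutations)
    next
      case False
      then obtain c where c: "c \<in> X" "\<not> inj_on (lquot c) Q" by blast
      interpret marked_alphabet R X Q c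
        by unfold_locales (use Q less.prems(1) c(1) in simp_all)
      have card_Q: "card (lquot c ` Q) < card Q"
        using c(2) card_image_le[OF Q(1), of "lquot c"] eq_card_imp_inj_on[OF Q(1), of "lquot c"]
        by linarith
      have "runs (X - marks) s t \<in> ltl_langs R (alike Q) (X - marks)" if "s \<in> Q" for s t
        using less.hyps card_unmarked_letters stable_unmarked that by blast
      moreover have "runs (block_letters marks X) s t \<in>
          ltl_langs R (alike (lquot c ` Q)) (block_letters marks X)" if "s \<in> lquot c ` Q" for s t
        using mark_image_subset
        by (intro outer_IH card_Q finite_imageI Q stable_block_letters that) auto
      ultimately show ?thesis
        using runs_marked_alphabet less.prems(2) by blast
    qed
  qed
qed

end

section \<open>From star-free expressions to future formulas\<close>

definition future_definable :: "'a list set set \<Rightarrow> 'a list set \<Rightarrow> bool" where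
  "future_definable C V \<longleftrightarrow>
    (\<exists>\<phi>. mlangs \<phi> \<subseteq> C \<and> future \<phi> \<and> (\<forall>u v. sat_after \<phi> u v \<longleftrightarrow> v \<in> V))"

lemma future_definable_empty: "future_definable C {}"
  unfolding future_definable_def by (rule exI[of _ "Neg TT"]) (simp add: sat_after_def)

lemma future_definable_Un:
  assumes "future_definable C V" "future_definable C W"
  shows "future_definable C (V \<union> W)"
proof -
  obtain \<phi> \<psi> where "mlangs \<phi> \<subseteq> C" "future \<phi>" "\<And>u v. sat_after \<phi> u v \<longleftrightarrow> v \<in> V"
    "mlangs \<psi> \<subseteq> C" "future \<psi>" "\<And>u v. sat_after \<psi> u v \<longleftrightarrow> v \<in> W"
    using assms unfolding future_definable_def by metis
  then show ?thesis
    unfolding future_definable_def by (intro exI[of _ "Or \<phi> \<psi>"]) (simp add: sat_after_def)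
qed

lemma future_definable_Compl:
  assumes "future_definable C V"
  shows "future_definable C (- V)"
proof -
  obtain \<phi> where "mlangs \<phi> \<subseteq> C" "future \<phi>" "\<And>u v. sat_after \<phi> u v \<longleftrightarrow> v \<in> V"
    using assms unfolding future_definable_def by metis
  then show ?thesis
    unfolding future_definable_def by (intro exI[of _ "Neg \<phi>"]) (simp add: sat_after_def)
qed

lemma future_definable_Int:
  assumes "future_definable C V" "future_definable C W"
  shows "future_definable C (V \<inter> W)"
proof -
  have "V \<inter> W = - (- V \<union> - W)" by blast
  then show ?thesis using assms by (simp only: future_definable_Compl future_definable_Un)
qed

lemma future_definable_UN:
  assumes "finite A" "\<And>a. a \<in> A \<Longrightarrow> future_definable C (V a)"
  shows "future_definable C (\<Union>a\<in>A. V a)"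
  using assms
  by (induction rule: finite_induct) (auto intro: future_definable_empty future_definable_Un)

lemma sat_before_Until_iff_until_lang:
  assumes "\<And>u v. sat_after \<phi> u v \<longleftrightarrow> v \<in> P" "\<And>u v. sat_after \<psi> u v \<longleftrightarrow> v \<in> T"
  shows "sat_before (Until L \<phi> \<psi>) u w \<longleftrightarrow> w \<in> until_lang L P T"
  unfolding sat_before_Until until_relation_def using assms
  by (auto simp: until_lang_def holding_inside_def)

lemma future_definable_Cons_until:
  assumes L: "L \<in> C" and "future_definable C P" "future_definable C T"
  shows "future_definable C ((#) a ` until_lang L P T)"
proof -
  obtain \<phi> \<psi> where \<phi>: "mlangs \<phi> \<subseteq> C" "future \<phi>" "\<And>u v. sat_after \<phi> u v \<longleftrightarrow> v \<in> P"
    and \<psi>: "mlangs \<psi> \<subseteq> C" "future \<psi>" "\<And>u v. sat_after \<psi> u v \<longleftrightarrow> v \<in> T"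
    using assms(2,3) unfolding future_definable_def by metis
  have "sat_after (And (Lab a) (Until L \<phi> \<psi>)) u w \<longleftrightarrow> w \<in> (#) a ` until_lang L P T" for u w
  proof (cases w)
    case Nil
    then show ?thesis by (auto simp: sat_after_def)
  next
    case (Cons b v)
    have "sat_after (And (Lab a) (Until L \<phi> \<psi>)) u w \<longleftrightarrow> b = a \<and> sat_before (Until L \<phi> \<psi>) (u @ [b]) v"
      unfolding Cons sat_after_Cons by (simp add: sat_before_def del: sat.simps(8))
    then show ?thesis
      using sat_before_Until_iff_until_lang[OF \<phi>(3) \<psi>(3)] Cons by auto
  qed
  then show ?thesis
    unfolding future_definable_def using L \<phi>(1,2) \<psi>(1,2)
    by (intro exI[of _ "And (Lab a) (Until L \<phi> \<psi>)"]) simp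
qed

lemma until_lang_UNIV_empty: "until_lang UNIV {} V = V"
proof (rule set_eqI)
  show "w \<in> until_lang UNIV {} V \<longleftrightarrow> w \<in> V" for w by (cases w) (simp_all add: until_lang_simps)
qed

lemma future_definable_Cons:
  assumes "UNIV \<in> C" "future_definable C V"
  shows "future_definable C ((#) a ` V)"
  using future_definable_Cons_until[OF assms(1) future_definable_empty assms(2)]
  by (simp add: until_lang_UNIV_empty)

lemma future_definable_until:
  fixes C :: "'a::finite list set set"
  assumes C: "\<And>a. lquot [a] L \<in> C" and P: "future_definable C P" and T: "future_definable C T"
  shows "future_definable C (until_lang L P T)"
proof -
  let ?U = "\<lambda>a. (#) a ` until_lang (lquot [a] L) P T"
  have "w \<in> until_lang L P T \<longleftrightarrow> w \<in> (if [] \<in> L then T else {}) \<union> (P \<inter> (\<Union>a. ?U a))" for w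
    by (cases w) (auto simp: until_lang_simps)
  then have "until_lang L P T = (if [] \<in> L then T else {}) \<union> (P \<inter> (\<Union>a. ?U a))" by blast
  moreover have "future_definable C ((if [] \<in> L then T else {}) \<union> (P \<inter> (\<Union>a. ?U a)))"
    using T by (intro future_definable_Un future_definable_Int future_definable_UN
        future_definable_Cons_until C P T) (simp_all add: future_definable_empty)
  ultimately show ?thesis by simp
qed

lemma map_vimage_until_lang:
  "map h -` until_lang M P T = until_lang (map h -` M) (map h -` P) (map h -` T)"
proof (rule set_eqI)
  have lquot: "lquot [a] (map h -` K) = map h -` lquot [h a] K" for a K by auto
  fix w
  show "w \<in> map h -` until_lang M P T \<longleftrightarrow> w \<in> until_lang (map h -` M) (map h -` P) (map h -` T)"
    by (induction w arbitrary: M) (simp_all add: until_lang_simps lquot)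
qed

lemma ltl_langs_future_definable:
  fixes C :: "'a::finite list set set"
  assumes C: "quotient_algebra C" and R: "quotient_algebra.congruence_over C R"
    and V: "V \<in> ltl_langs R S (range (\<lambda>a. [a]))"
  shows "future_definable C (map (\<lambda>a. [a]) -` V)"
proof -
  interpret quotient_algebra C by (rule C)
  let ?h = "map (\<lambda>a :: 'a. [a])"
  show ?thesis
    using V
  proof (induction rule: ltl_langs.induct)
    case ltl_empty
    then show ?case by (simp add: future_definable_empty)
  next
    case (ltl_Un P T)
    then show ?case by (simp add: future_definable_Un)
  next
    case (ltl_compl P)
    have "?h -` (lists (range (\<lambda>a. [a])) - P) = - ?h -` P" by auto
    then show ?case using future_definable_Compl[OF ltl_compl.IH] by simp
  next
    case (ltl_Cons F P)
    have "w \<in> ?h -` set_Cons (F \<inter> range (\<lambda>a. [a])) P \<longleftrightarrow> w \<in> (\<Union>a\<in>{a. [a] \<in> F}. (#) a ` ?h -` P)" for w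
      by (cases w) (auto simp: Cons_mem_set_Cons Nil_notin_set_Cons)
    then have "?h -` set_Cons (F \<inter> range (\<lambda>a. [a])) P = (\<Union>a\<in>{a. [a] \<in> F}. (#) a ` ?h -` P)"
      by blast
    then show ?case
      by (simp add: future_definable_UN future_definable_Cons UNIV_mem ltl_Cons.IH)
  next
    case (ltl_until L P T)
    have "?h -` concat -` L = L" by auto
    moreover have "lquot [a] L \<in> C" for a
      by (rule lquot_mem[OF saturated_mem[OF R ltl_until.hyps(1)]])
    ultimately show ?case
      unfolding map_vimage_until_lang by (simp add: future_definable_until ltl_until.IH)
  qed
qed

lemma future_definable_imp_LTL:
  assumes C: "UNIV \<in> C" and "future_definable C V"
  shows "V \<in> LTL C"
proof -
  obtain \<phi> where \<phi>: "mlangs \<phi> \<subseteq> C" "future \<phi>" "\<And>u v. sat_after \<phi> u v \<longleftrightarrow> v \<in> V"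
    using assms(2) unfolding future_definable_def by metis
  let ?\<psi> = "Until UNIV (Neg TT) \<phi>"
  have "sat_before ?\<psi> [] w \<longleftrightarrow> w \<in> until_lang UNIV {} V" for w
    by (rule sat_before_Until_iff_until_lang) (simp_all add: \<phi>(3) sat_after_def[of "Neg TT"])
  then have "V = lang_of ?\<psi>"
    by (auto simp: lang_of_def sat_before_def until_lang_UNIV_empty simp del: sat.simps)
  moreover have "mlangs ?\<psi> \<subseteq> C" "future ?\<psi>" using \<phi>(1,2) C by simp_all
  ultimately show ?thesis unfolding LTL_def by blast
qed

lemma SF_subset_LTL:
  assumes "prevariety C"
  shows "SF C \<subseteq> LTL C"
proof
  fix K assume K: "K \<in> SF C"
  interpret quotient_algebra C by (rule prevariety_quotient_algebra[OF assms])
  interpret SF: concatenation_algebra "SF C" by (rule concatenation_algebra_SF[OF assms])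
  obtain R n where R: "congruence_over R" "pumps R n K"
    using SF_pumps[OF quotient_algebra_axioms K] by blast
  interpret finite_congruence R by (rule congruence_over_finite_congruence[OF R(1)])
  let ?Q = "range (\<lambda>u. lquot u K)" and ?X = "range (\<lambda>a. [a])"
  have "finite ?Q" using SF.finite_index_mem[OF K] by (simp add: finite_index_def)
  have "K \<in> ?Q" by (rule image_eqI[of _ _ "[]"]) simp_all
  have "runs ?X K q \<in> ltl_langs R (alike ?Q) ?X" for q
  proof (rule runs_definable[OF \<open>finite ?Q\<close> _ _ _ \<open>K \<in> ?Q\<close>])
    show "stable ?X ?Q" by (auto simp: stable_def simp flip: lquot_append)
  qed (auto intro: SF.finite_index_mem SF.lquot_mem K pumps_lquot R(2))
  then have "(\<Union>q\<in>{q \<in> ?Q. [] \<in> q}. runs ?X K q) \<in> ltl_langs R (alike ?Q) ?X"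
    using \<open>finite ?Q\<close> by (intro ltl_UN) simp_all
  then have "future_definable C (map (\<lambda>a. [a]) -` (\<Union>q\<in>{q \<in> ?Q. [] \<in> q}. runs ?X K q))"
    by (rule ltl_langs_future_definable[OF quotient_algebra_axioms R(1)])
  moreover have "map (\<lambda>a. [a]) -` (\<Union>q\<in>{q \<in> ?Q. [] \<in> q}. runs ?X K q) = K"
    by (rule set_eqI) (simp add: runs_def in_lists_conv_set)
  ultimately show "K \<in> LTL C" by (simp add: future_definable_imp_LTL UNIV_mem)
qed

theorem theorem7p4:
  fixes C :: "('a::finite) list set set"
  assumes "prevariety C"
  shows "SF C = LTL C \<and> LTL C = LTLP C"
proof -
  have "LTL C \<subseteq> LTLP C" by (auto simp: LTL_def LTLP_def)
  then show ?thesis using SF_subset_LTL[OF assms] LTLP_subset_SF[OF assms] by blast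
qed

end
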